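(* Let $\Upsilon$ be the (nonempty) collection of all weakly dominant sets, $\Omega$ the collection of all minimally critical sets, and $\mathcal N=|\mathcal I|$. Suppose that every $S\in\Upsilon$, with $c=c_S$, satisfies the following five assumptions. (1) For any $y\in\mathbb R$ and $\delta>0$, $F_S^c(\delta):=\liminf_{x\to\infty}\frac{\mathbb P\{\mathbf V_S^{c+\delta}>x+y\}}{\mathbb P\{\mathbf V_S^c>x\}}$ is independent of $y$, and $\lim_{\delta\downarrow0}F_S^c(\delta)=1$. (2) For any $y\in\mathbb R$ and $\delta>0$ (with $c-\delta>\rho_S$), $G_S^c(\delta):=\limsup_{x\to\infty}\frac{\mathbb P\{\mathbf V_S^{c-\delta}>x-y\}}{\mathbb P\{\mathbf V_S^c>x\}}$ is independent of $y$, and $\lim_{\delta\downarrow0}G_S^c(\delta)=1$. (3) For any $\varepsilon>0$, $\lim_{x\to\infty}\frac{\mathbb P\{\mathbf V_{\mathcal I_1}^{\rho_{\mathcal I_1}+\varepsilon}>x/\mathcal N\}}{\mathbb P\{\mathbf V_S^c>x\}}=0$. (4) For any $\varepsilon>0$, $\limsup_{x\to\infty}\frac{\prod_{j\in S}\mathbb P\{\mathbf V_j^{\rho_j+\varepsilon}>x/\mathcal N\}}{\mathbb P\{\mathbf V_S^c>x\}}<\infty$. (5) For any $E\in\Omega\setminus\Upsilon$ and any $\varepsilon>0$, $\lim_{x\to\infty}\frac{\prod_{j\in E}\mathbb P\{\mathbf V_j^{\rho_j+\varepsilon}>x/\mathcal N\}}{\mathbb P\{\mathbf V_S^c>x\}}=0$.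 Then, as $x\to\infty$, $$\mathbb P\{\mathbf V>x\}\sim\sum_{S\in\Upsilon}\mathbb P\{\mathbf V_S^{c_S}>x\}.$$
   Context: Model. A fluid queue of capacity $1$ is fed by a finite set $\mathcal I=\mathcal I_1\cup\mathcal I_2$ (disjoint union) of flows. $A_i(s,t)$ is the traffic generated by flow $i$ in $(s,t]$; $\rho_i$ is its traffic intensity (long-run mean rate). For $E\subseteq\mathcal I$: $A_E(s,t)=\sum_{i\in E}A_i(s,t)$, $\rho_E=\sum_{i\in E}\rho_i$. Stability: $\rho_{\mathcal I}<1$. For $c\ge0$, $V_E^c(t)=\sup_{0\le s\le t}\{A_E(s,t)-c(t-s)\}$; for $c>\rho_E$, $\mathbf V_E^c$ is a random variable with the limiting distribution of $V_E^c(t)$ as $t\to\infty$; $\mathbf V_j^c=\mathbf V_{\{j\}}^c$ and $\mathbf V=\mathbf V_{\mathcal I}^1$. For $c<\rho_E$, $\mathbf Z_E^c$ is a random variable with the limiting distribution of $\sup_{0\le s\le t}\{c(t-s)-A_E(s,t)\}$. These limiting distributions are assumed to exist and to be proper. The flows in $\mathcal I_2$ are independent of each other and of the traffic of $\mathcal I_1$. Light-tailed flows $\mathcal I_1$: for all $c>\rho_{\mathcal I_1}$ and $\mu>0$, $\lim_{x\to\infty}x^\mu\,\mathbb P\{\mathbf V_{\mathcal I_1}^c>x\}=0$. Heavy-tailed flows $\mathcal I_2$: each $i\in\mathcal I_2$ is a (stationary) On–Off process alternating between i.i.d. On periods distributed as $\mathbf A_i$ with mean $\alpha_i<\infty$ and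 i.i.d. Off periods of general distribution with mean $1/\lambda_i<\infty$, On and Off periods being independent. While On it produces traffic at constant rate $r_i$; while Off it produces none. $p_i=\lambda_i\alpha_i/(1+\lambda_i\alpha_i)$ is the fraction of time On, and $\rho_i=p_ir_i$. The distribution of $\mathbf A_i$ is regularly varying of index $-\nu_i$ with $\nu_i>1$. Critical sets. For $S\subseteq\mathcal I_2$: $r_S=\sum_{j\in S}r_j$, $c_S=1-\rho_{\mathcal I\setminus S}$, $d_S=r_S-c_S$, $\mu_S=\sum_{j\in S}(\nu_j-1)$. $S$ is critical if $d_S\ge0$, strictly critical if $d_S>0$, and minimally critical if it is critical and no proper subset of it is critical (equivalently $0\le d_S<\min_{j\in S}\{r_j-\rho_j\}$). A strictly critical set $S\subseteq\mathcal I_2$ is weakly dominant if $\mu_S\le\mu_U$ for every other critical set $U\subseteq\mathcal I_2$. Notation: $f(x)\sim g(x)$ means $f(x)/g(x)\to1$ as $x\to\infty$. *)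

theory Defs
  imports "HOL-Probability.Probability" "HOL-Library.Landau_Symbols"
begin

section \<open>Stationary On-Off flows\<close>

definition regularly_varying :: "(real \<Rightarrow> real) \<Rightarrow> real \<Rightarrow> bool" where
  "regularly_varying f \<kappa> \<longleftrightarrow>
     (\<forall>\<^sub>F x in at_top. 0 < f x) \<and>
     (\<forall>a>0. ((\<lambda>x. f (a * x) / f x) \<longlongrightarrow> a powr \<kappa>) at_top)"

definition mean :: "real measure \<Rightarrow> real" where
  "mean D = (\<integral>x. x \<partial>D)"

definition duration_law :: "real measure \<Rightarrow> bool" where
  "duration_law D \<longleftrightarrow> real_distribution D \<and> (AE x in D. 0 \<le> x) \<and> integrable D (\<lambda>x. x)"

text \<open>The equilibrium residual lifetime: density $P(D > x) / E D$ on $[0,\infty)$.\<close>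

definition residual_law :: "real measure \<Rightarrow> real measure" where
  "residual_law D =
     density lborel (\<lambda>x. ennreal (indicator {0..} x * measure D {x<..} / mean D))"

text \<open>The joint law of the state at time 0 (\<^term>\<open>True\<close> means On) and of the remaining length of the
  period in progress at time 0, for the stationary On-Off process: On with probability \<open>p\<close>, and
  given the state, the remaining length is an equilibrium residual On or Off period.\<close>

definition initial_law :: "real \<Rightarrow> real measure \<Rightarrow> real measure \<Rightarrow> (bool \<times> real) measure" where
  "initial_law p F U =
     distr (measure_pmf (bernoulli_pmf p) \<Otimes>\<^sub>M (residual_law F \<Otimes>\<^sub>M residual_law U))
       (count_space UNIV \<Otimes>\<^sub>M borel) (\<lambda>(b, a, u). (b, if b then a else u))"

text \<open>A trajectory is given by the initial state and remaining length, the sequence of subsequent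
  On periods and the sequence of subsequent Off periods. The three are independent, and the periods
  in each of the two sequences are i.i.d.\<close>

type_synonym on_off_data = "(bool \<times> real) \<times> (nat \<Rightarrow> real) \<times> (nat \<Rightarrow> real)"

definition on_off_law :: "real \<Rightarrow> real measure \<Rightarrow> real measure \<Rightarrow> on_off_data measure" where
  "on_off_law p F U =
     initial_law p F U \<Otimes>\<^sub>M (PiM UNIV (\<lambda>_. F) \<Otimes>\<^sub>M PiM UNIV (\<lambda>_. U))"

text \<open>Period 0 is the one in progress at time 0; the \<open>k\<close>-th period is On iff the initial state is On
  and \<open>k\<close> is even, or the initial state is Off and \<open>k\<close> is odd.\<close>

fun period_length :: "on_off_data \<Rightarrow> nat \<Rightarrow> real" where
  "period_length ((b, v), a, u) 0 = v"
| "period_length ((b, v), a, u) (Suc n) = (if b = even (Suc n) then a (n div 2) else u (n div 2))"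

definition period_start :: "on_off_data \<Rightarrow> nat \<Rightarrow> real" where
  "period_start \<xi> k = (\<Sum>j<k. period_length \<xi> j)"

definition on_at :: "on_off_data \<Rightarrow> real \<Rightarrow> bool" where
  "on_at \<xi> t \<longleftrightarrow>
     (\<exists>k. fst (fst \<xi>) = even k \<and> period_start \<xi> k \<le> t \<and> t < period_start \<xi> (Suc k))"

text \<open>\<open>X s t\<close> is the traffic in $(s,t]$ of a stationary On-Off flow with rate \<open>r\<close>, fraction \<open>p\<close> of
  time On, and On and Off periods with laws \<open>F\<close> and \<open>U\<close>.\<close>

definition on_off_flow ::
  "'a measure \<Rightarrow> (real \<Rightarrow> real \<Rightarrow> 'a \<Rightarrow> real) \<Rightarrow> real \<Rightarrow> real \<Rightarrow> real measure \<Rightarrow> real measure \<Rightarrow> bool"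
  where
  "on_off_flow M X r p F U \<longleftrightarrow>
     (\<exists>\<xi> \<in> M \<rightarrow>\<^sub>M on_off_law p F U.
        distr M (on_off_law p F U) \<xi> = on_off_law p F U \<and>
        (\<forall>\<omega>\<in>space M. \<forall>s t. 0 \<le> s \<longrightarrow> s \<le> t \<longrightarrow>
           X s t \<omega> = r * measure lborel {v \<in> {s<..t}. on_at (\<xi> \<omega>) v}))"


section \<open>The fluid queue\<close>

text \<open>\<open>traffic Q i s t \<omega>\<close> is $A_i(s,t)$ for $0 \le s \le t$; \<open>intensity\<close> is $\rho_i$. The last four
  fields are meaningful for the heavy-tailed flows only: the rate $r_i$ while On, the laws of the On
  and of the Off periods, and $\nu_i$.\<close>

record ('i, 'a) fluid_queue =
  sample :: "'a measure"
  light :: "'i set"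
  heavy :: "'i set"
  traffic :: "'i \<Rightarrow> real \<Rightarrow> real \<Rightarrow> 'a \<Rightarrow> real"
  intensity :: "'i \<Rightarrow> real"
  peak_rate :: "'i \<Rightarrow> real"
  on_period :: "'i \<Rightarrow> real measure"
  off_period :: "'i \<Rightarrow> real measure"
  tail_index :: "'i \<Rightarrow> real"

definition flows :: "('i, 'a) fluid_queue \<Rightarrow> 'i set" where
  "flows Q = light Q \<union> heavy Q"

definition rho :: "('i, 'a) fluid_queue \<Rightarrow> 'i set \<Rightarrow> real" where
  "rho Q E = (\<Sum>i\<in>E. intensity Q i)"

definition workload :: "('i, 'a) fluid_queue \<Rightarrow> 'i set \<Rightarrow> real \<Rightarrow> real \<Rightarrow> 'a \<Rightarrow> real" where
  "workload Q E c t \<omega> = (SUP s\<in>{0..t}. (\<Sum>i\<in>E. traffic Q i s t \<omega>) - c * (t - s))"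

definition deficit :: "('i, 'a) fluid_queue \<Rightarrow> 'i set \<Rightarrow> real \<Rightarrow> real \<Rightarrow> 'a \<Rightarrow> real" where
  "deficit Q E c t \<omega> = (SUP s\<in>{0..t}. c * (t - s) - (\<Sum>i\<in>E. traffic Q i s t \<omega>))"

text \<open>\<open>L\<close> is a proper probability law, and \<open>W t\<close> converges to it in distribution as
  $t \to \infty$ (through the reals).\<close>

definition limiting_law :: "'a measure \<Rightarrow> (real \<Rightarrow> 'a \<Rightarrow> real) \<Rightarrow> real measure \<Rightarrow> bool" where
  "limiting_law M W L \<longleftrightarrow> real_distribution L \<and>
     (\<forall>\<tau>. filterlim \<tau> at_top sequentially \<longrightarrow> weak_conv_m (\<lambda>n. distr M borel (W (\<tau> n))) L)"

text \<open>The law of $\mathbf V_E^c$. Limits in distribution are unique, so the choice is immaterial.\<close>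

definition V_law :: "('i, 'a) fluid_queue \<Rightarrow> 'i set \<Rightarrow> real \<Rightarrow> real measure" where
  "V_law Q E c = (SOME L. limiting_law (sample Q) (workload Q E c) L)"

definition V_tail :: "('i, 'a) fluid_queue \<Rightarrow> 'i set \<Rightarrow> real \<Rightarrow> real \<Rightarrow> real" where
  "V_tail Q E c x = measure (V_law Q E c) {x<..}"

definition off_rate :: "('i, 'a) fluid_queue \<Rightarrow> 'i \<Rightarrow> real" where
  "off_rate Q i = 1 / mean (off_period Q i)"

definition on_fraction :: "('i, 'a) fluid_queue \<Rightarrow> 'i \<Rightarrow> real" where
  "on_fraction Q i =
     off_rate Q i * mean (on_period Q i) / (1 + off_rate Q i * mean (on_period Q i))"

definition heavy_flow :: "('i, 'a) fluid_queue \<Rightarrow> 'i \<Rightarrow> bool" where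
  "heavy_flow Q i \<longleftrightarrow>
     duration_law (on_period Q i) \<and>
     duration_law (off_period Q i) \<and> 0 < mean (off_period Q i) \<and>
     1 < tail_index Q i \<and>
     regularly_varying (\<lambda>x. measure (on_period Q i) {x<..}) (- tail_index Q i) \<and>
     0 < peak_rate Q i \<and>
     on_off_flow (sample Q) (traffic Q i) (peak_rate Q i) (on_fraction Q i)
       (on_period Q i) (off_period Q i) \<and>
     intensity Q i = on_fraction Q i * peak_rate Q i"

text \<open>Right-continuity expresses that the traffic is counted over the half-open interval $(s,t]$.\<close>

definition traffic_path :: "(real \<Rightarrow> real \<Rightarrow> real) \<Rightarrow> bool" where
  "traffic_path a \<longleftrightarrow>
     (\<forall>s t. 0 \<le> s \<longrightarrow> s \<le> t \<longrightarrow> 0 \<le> a s t) \<and>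
     (\<forall>s t u. 0 \<le> s \<longrightarrow> s \<le> t \<longrightarrow> t \<le> u \<longrightarrow> a s u = a s t + a t u) \<and>
     (\<forall>t\<ge>0. continuous (at_right t) (a 0))"

text \<open>Independence of the traffic processes of the individual heavy-tailed flows and of the joint
  traffic process of the light-tailed flows.\<close>

definition independent_flows :: "('i, 'a) fluid_queue \<Rightarrow> bool" where
  "independent_flows Q \<longleftrightarrow>
     prob_space.indep_vars (sample Q)
       (\<lambda>E. PiM (E \<times> {(s, t). 0 \<le> s \<and> s \<le> t}) (\<lambda>_. borel))
       (\<lambda>E \<omega>. \<lambda>(i, s, t)\<in>E \<times> {(s, t). 0 \<le> s \<and> s \<le> t}. traffic Q i s t \<omega>)
       (insert (light Q) ((\<lambda>i. {i}) ` heavy Q))"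

locale fluid_model =
  fixes Q :: "('i, 'a) fluid_queue"
  assumes prob: "prob_space (sample Q)"
    and finite_flows: "finite (flows Q)"
    and disjoint_flows: "light Q \<inter> heavy Q = {}"
    and traffic_paths: "\<And>i \<omega>. i \<in> flows Q \<Longrightarrow> \<omega> \<in> space (sample Q) \<Longrightarrow>
          traffic_path (\<lambda>s t. traffic Q i s t \<omega>)"
    and independent: "independent_flows Q"
    and light_intensity: "\<And>i. i \<in> light Q \<Longrightarrow>
          AE \<omega> in sample Q. ((\<lambda>t. traffic Q i 0 t \<omega> / t) \<longlongrightarrow> intensity Q i) at_top"
    and heavy_flows: "\<And>i. i \<in> heavy Q \<Longrightarrow> heavy_flow Q i"
    and stability: "rho Q (flows Q) < 1"
    and workload_limit: "\<And>E c. E \<subseteq> flows Q \<Longrightarrow> rho Q E < c \<Longrightarrow>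
          \<exists>L. limiting_law (sample Q) (workload Q E c) L"
    and deficit_limit: "\<And>E c. E \<subseteq> flows Q \<Longrightarrow> c < rho Q E \<Longrightarrow>
          \<exists>L. limiting_law (sample Q) (deficit Q E c) L"
    and light_tail: "\<And>c \<mu>. rho Q (light Q) < c \<Longrightarrow> 0 < \<mu> \<Longrightarrow>
          ((\<lambda>x. x powr \<mu> * V_tail Q (light Q) c x) \<longlongrightarrow> 0) at_top"


section \<open>Critical sets\<close>

definition cap :: "('i, 'a) fluid_queue \<Rightarrow> 'i set \<Rightarrow> real" where
  "cap Q S = 1 - rho Q (flows Q - S)"

definition drift :: "('i, 'a) fluid_queue \<Rightarrow> 'i set \<Rightarrow> real" where
  "drift Q S = (\<Sum>j\<in>S. peak_rate Q j) - cap Q S"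

definition decay :: "('i, 'a) fluid_queue \<Rightarrow> 'i set \<Rightarrow> real" where
  "decay Q S = (\<Sum>j\<in>S. tail_index Q j - 1)"

definition critical :: "('i, 'a) fluid_queue \<Rightarrow> 'i set \<Rightarrow> bool" where
  "critical Q S \<longleftrightarrow> S \<subseteq> heavy Q \<and> 0 \<le> drift Q S"

definition strictly_critical :: "('i, 'a) fluid_queue \<Rightarrow> 'i set \<Rightarrow> bool" where
  "strictly_critical Q S \<longleftrightarrow> S \<subseteq> heavy Q \<and> 0 < drift Q S"

definition minimally_critical :: "('i, 'a) fluid_queue \<Rightarrow> 'i set \<Rightarrow> bool" where
  "minimally_critical Q S \<longleftrightarrow> critical Q S \<and> (\<forall>U. U \<subset> S \<longrightarrow> \<not> critical Q U)"

definition weakly_dominant :: "('i, 'a) fluid_queue \<Rightarrow> 'i set \<Rightarrow> bool" where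
  "weakly_dominant Q S \<longleftrightarrow>
     strictly_critical Q S \<and> (\<forall>U. critical Q U \<longrightarrow> U \<noteq> S \<longrightarrow> decay Q S \<le> decay Q U)"

end

theory Submission
  imports Defs
begin

text \<open>The workload of the whole queue is compared, path by path, with workloads of subsets of the flows in
isolation; independence turns the comparisons into products of probabilities, and only then time tends
to infinity.

For the upper bound (\<open>overflow_needs_minimally_critical_set\<close>, \<open>overflow_prob_upper\<close>), serve every
heavy-tailed flow $j$ and the light-tailed aggregate separately, each at a rate slightly above its mean.
If the queue exceeds $x$ while the light-tailed aggregate stays below $x / N$, then the flows that
individually exceed $x / N$ must form a critical set, because otherwise the remaining capacity
would carry them even if all of them were On. They contain a minimally critical set $E$. By the
assumptions on light traffic and on nondominant $E$, all this is negligible unless $E$ is weakly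
dominant. For a weakly dominant $S$, let the remaining flows be served at $\delta$ above their mean
rate. If their workload is at most $y$, then $S$ alone, served at rate $c_S - \delta$, exceeds $x - y$.
If it is more than $y$, then independence bounds the probability by the product over $j \in S$, which
is of the order of the tail of $S$, times a factor that is small for large $y$.

For the lower bound (\<open>overflow_prob_lower\<close>), $S$ alone at rate $c_S + \delta$ exceeding $x + y$ forces
an overflow unless the remaining flows fall short of their mean rate by more than $y$, which is
independent of $S$ and unlikely. By Bonferroni's inequality it remains to see that two dominant sets
seldom exceed together. A weakly dominant set is minimally critical, so that every one of its flows
must be large by itself (\<open>minimally_critical_all_large\<close>); as $T$ is not contained in $S$, a further
flow outside $S$ must then be large as well.

The change of rate from $c_S$ to $c_S \pm \delta$ and the shift by $y$ cost a factor close to 1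
by the assumptions on the tails of $S$. The On-Off structure enters through the bound $r_j (t - s)$ on
the traffic of flow $j$, and $\nu_j > 1$ makes weakly dominant sets minimally critical.\<close>

section \<open>Tails of limiting laws\<close>

lemma AE_lborel_obtains_in_interval:
  fixes a b :: real
  assumes "AE x in lborel. P x" and "a < b"
  obtains x where "a < x" "x < b" "P x"
proof (rule ccontr)
  assume neg: "\<not> thesis"
  have "AE x in lborel. x \<notin> {a<..<b}"
    using assms(1) by eventually_elim (use neg that in auto)
  then have "{a<..<b} \<in> null_sets lborel"
    by (subst (asm) AE_iff_null_sets[symmetric]) auto
  then show False
    using assms(2) by (auto simp: null_sets_def)
qed

text \<open>Convergence in distribution yields inequalities between tails only at arguments that avoid atoms, that
is, at almost all arguments. Tails are right continuous, which carries such an inequality to every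
argument.\<close>

lemma le_of_AE_le_right_continuous:
  fixes f g :: "real \<Rightarrow> real"
  assumes AE: "AE z in lborel. x < z \<longrightarrow> f z \<le> g z"
    and f: "(f \<longlongrightarrow> f x) (at_right x)" and g: "(g \<longlongrightarrow> g x) (at_right x)"
  shows "f x \<le> g x"
proof (rule ccontr)
  assume "\<not> f x \<le> g x"
  then have "\<forall>\<^sub>F z in at_right x. 0 < f z - g z"
    by (intro order_tendstoD(1)[OF tendsto_diff[OF f g]]) auto
  then obtain b where b: "x < b" "\<And>z. x < z \<Longrightarrow> z < b \<Longrightarrow> 0 < f z - g z"
    unfolding eventually_at_right_field by blast
  obtain z where "x < z" "z < b" "x < z \<longrightarrow> f z \<le> g z"
    using AE_lborel_obtains_in_interval[OF AE b(1)] .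
  with b(2)[of z] show False
    by simp
qed

lemma tail_eq_cdf:
  assumes "real_distribution L"
  shows "measure L {x<..} = 1 - cdf L x"
proof -
  interpret real_distribution L by fact
  have "{x<..} = space L - {..x}"
    by auto
  then show ?thesis
    by (simp add: cdf_def prob_compl[symmetric])
qed

text \<open>Tails will be compared at $x / N$ and at $x \pm y$ simultaneously, so one $x$ has to avoid the atoms of
several laws after different affine changes of variable. Each law excludes only countably many $x$.\<close>

lemma AE_atomless_affine:
  assumes "real_distribution L" and "a \<noteq> (0::real)"
  shows "AE x in lborel. measure L {a * x + b} = 0"
proof -
  interpret real_distribution L by fact
  have "{x. measure L {a * x + b} > 0} \<subseteq> (\<lambda>y. (y - b) / a) ` {y. measure L {y} > 0}"
    using assms(2) by (auto intro!: image_eqI[where x="a * x + b" for x])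
  then have "countable {x. measure L {a * x + b} > 0}"
    using countable_subset countable_image countable_atoms by metis
  then have "AE x in lborel. x \<notin> {x. measure L {a * x + b} > 0}"
    by (intro AE_not_in countable_imp_null_set_lborel)
  then show ?thesis
    by eventually_elim (use measure_nonneg[of L] in \<open>auto simp: less_le\<close>)
qed

lemma tail_affine_right_continuous:
  assumes "real_distribution L" and "(0::real) < a"
  shows "((\<lambda>z. measure L {a * z + b<..}) \<longlongrightarrow> measure L {a * x + b<..}) (at_right x)"
proof -
  interpret real_distribution L by fact
  have "filterlim (\<lambda>z. a * z + b) (at_right (a * x + b)) (at_right x)"
    unfolding filterlim_at
    using assms(2) by (auto intro!: tendsto_intros simp: eventually_at_filter)
  from filterlim_compose[OF cdf_is_right_cont[of "a * x + b", unfolded continuous_within] this]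
  show ?thesis
    by (auto simp: tail_eq_cdf[OF assms(1)] intro!: tendsto_intros)
qed

lemma tail_tendsto_0:
  assumes "real_distribution L"
  shows "((\<lambda>x. measure L {x<..}) \<longlongrightarrow> 0) at_top"
proof -
  interpret real_distribution L by fact
  show ?thesis
    using tendsto_diff[OF tendsto_const[of 1] cdf_lim_at_top_prob] tail_eq_cdf[OF assms] by simp
qed

text \<open>The limit over integer times already determines the limiting law, so all comparisons of limiting laws
below are obtained from comparisons at the times $0, 1, 2, \dots$.\<close>

lemma limiting_law_tail:
  assumes M: "prob_space M" and lim: "limiting_law M W L"
    and meas: "\<And>n::nat. W (real n) \<in> borel_measurable M"
    and atom: "measure L {x} = 0"
  shows "(\<lambda>n. measure M {\<omega> \<in> space M. x < W (real n) \<omega>}) \<longlonglongrightarrow> measure L {x<..}"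
proof -
  interpret prob_space M by fact
  have L: "real_distribution L"
    using lim by (simp add: limiting_law_def)
  then interpret L: real_distribution L .
  have "filterlim real at_top sequentially"
    by (rule filterlim_real_sequentially)
  with lim have "weak_conv_m (\<lambda>n. distr M borel (W (real n))) L"
    by (auto simp: limiting_law_def)
  then have "(\<lambda>n. 1 - cdf (distr M borel (W (real n))) x) \<longlonglongrightarrow> 1 - cdf L x"
    using atom by (auto simp: weak_conv_m_def weak_conv_def L.isCont_cdf intro!: tendsto_intros)
  moreover have "1 - cdf (distr M borel (W (real n))) x = measure M {\<omega> \<in> space M. x < W (real n) \<omega>}"
    for n
    using meas[of n]
    by (subst tail_eq_cdf[symmetric])
      (auto intro!: real_distribution_distr arg_cong[where f="measure M"] simp: measure_distr)
  ultimately show ?thesis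
    by (simp add: tail_eq_cdf[OF L])
qed

text \<open>The second Bonferroni inequality, in a form that subtracts every pair in both orders; this saves
ordering the index set and is just as good when the pairs are negligible.\<close>

lemma (in prob_space) prob_UNION_ge:
  assumes "finite I" and "\<And>i. i \<in> I \<Longrightarrow> B i \<in> events"
  shows "(\<Sum>i\<in>I. prob (B i)) - (\<Sum>i\<in>I. \<Sum>j\<in>I - {i}. prob (B i \<inter> B j)) \<le> prob (\<Union>i\<in>I. B i)"
  using assms
proof (induction I rule: finite_induct)
  case empty
  then show ?case by simp
next
  case (insert k I)
  have "prob (B k \<inter> (\<Union>i\<in>I. B i)) \<le> (\<Sum>i\<in>I. prob (B k \<inter> B i))"
    unfolding Int_UN_distrib
    by (rule finite_measure_subadditive_finite) (use insert in auto)
  moreover have "prob (B k \<union> (\<Union>i\<in>I. B i)) =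
      prob (B k) + prob (\<Union>i\<in>I. B i) - prob (B k \<inter> (\<Union>i\<in>I. B i))"
    by (rule measure_Un3) (use insert in \<open>auto simp: fmeasurable_eq_sets\<close>)
  moreover have "(\<Sum>i\<in>I. \<Sum>j\<in>insert k I - {i}. prob (B i \<inter> B j)) \<ge>
      (\<Sum>i\<in>I. \<Sum>j\<in>I - {i}. prob (B i \<inter> B j))"
    by (intro sum_mono sum_mono2) (use insert in auto)
  moreover have "insert k I - {k} = I"
    using insert by auto
  ultimately show ?case
    using insert.IH insert.prems insert.hyps by simp
qed

lemma on_off_flow_le_peak:
  assumes "on_off_flow M X r p F U" and "0 < r" and "\<omega> \<in> space M" and "0 \<le> s" "s \<le> t"
  shows "X s t \<omega> \<le> r * (t - s)"
proof -
  obtain \<xi> where X: "X s t \<omega> = r * measure lborel {v \<in> {s<..t}. on_at (\<xi> \<omega>) v}"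
    using assms unfolding on_off_flow_def by blast
  have "measure lborel {v \<in> {s<..t}. on_at (\<xi> \<omega>) v} \<le> t - s"
  proof (cases "{v \<in> {s<..t}. on_at (\<xi> \<omega>) v} \<in> sets lborel")
    case True
    then have "measure lborel {v \<in> {s<..t}. on_at (\<xi> \<omega>) v} \<le> measure lborel {s<..t}"
      by (intro measure_mono_fmeasurable) (auto simp: fmeasurable_def emeasure_lborel_Ioc assms)
    then show ?thesis
      using assms by simp
  next
    case False
    \<comment> \<open>The measure of a set that is not measurable is 0 by convention.\<close>
    then show ?thesis
      using assms by (simp add: measure_notin_sets)
  qed
  then show ?thesis
    using assms(2) X by simp
qed

section \<open>Measurability of the workload\<close>

context fluid_model
begin

definition net_input :: "'i set \<Rightarrow> real \<Rightarrow> real \<Rightarrow> real \<Rightarrow> 'a \<Rightarrow> real" where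
  "net_input E c s t \<omega> = (\<Sum>i\<in>E. traffic Q i s t \<omega>) - c * (t - s)"

text \<open>The sign $\sigma = 1$ gives the workload and $\sigma = -1$ the deficit, so that measurability and
independence are shown once for both.\<close>

definition extremal :: "real \<Rightarrow> 'i set \<Rightarrow> real \<Rightarrow> real \<Rightarrow> 'a \<Rightarrow> real" where
  "extremal \<sigma> E c t \<omega> = (SUP s\<in>{0..t}. \<sigma> * net_input E c s t \<omega>)"

lemma workload_eq_extremal: "workload Q E c t = extremal 1 E c t"
  by (rule ext) (simp add: workload_def extremal_def net_input_def)

lemma deficit_eq_extremal: "deficit Q E c t = extremal (- 1) E c t"
  by (rule ext) (simp add: deficit_def extremal_def net_input_def)

lemma finite_subset_flows: "E \<subseteq> flows Q \<Longrightarrow> finite E"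
  using finite_flows finite_subset by blast

lemma
  assumes "i \<in> flows Q" "\<omega> \<in> space (sample Q)"
  shows traffic_nonneg: "0 \<le> s \<Longrightarrow> s \<le> t \<Longrightarrow> 0 \<le> traffic Q i s t \<omega>"
    and traffic_split: "0 \<le> s \<Longrightarrow> s \<le> t \<Longrightarrow> traffic Q i s t \<omega> = traffic Q i 0 t \<omega> - traffic Q i 0 s \<omega>"
    and traffic_right_continuous: "0 \<le> s \<Longrightarrow> continuous (at_right s) (\<lambda>v. traffic Q i 0 v \<omega>)"
proof -
  note path = traffic_paths[OF assms, unfolded traffic_path_def]
  show "0 \<le> s \<Longrightarrow> s \<le> t \<Longrightarrow> 0 \<le> traffic Q i s t \<omega>"
    using path by blast
  show "continuous (at_right s) (\<lambda>v. traffic Q i 0 v \<omega>)" if "0 \<le> s"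
    using path that by blast
  have "traffic Q i 0 t \<omega> = traffic Q i 0 s \<omega> + traffic Q i s t \<omega>" if "0 \<le> s" "s \<le> t"
    using path that by blast
  then show "0 \<le> s \<Longrightarrow> s \<le> t \<Longrightarrow> traffic Q i s t \<omega> = traffic Q i 0 t \<omega> - traffic Q i 0 s \<omega>"
    by simp
qed

lemma net_input_split:
  assumes "E \<subseteq> flows Q" "\<omega> \<in> space (sample Q)" "0 \<le> s" "s \<le> t"
  shows "net_input E c s t \<omega> =
    (\<Sum>i\<in>E. traffic Q i 0 t \<omega>) - (\<Sum>i\<in>E. traffic Q i 0 s \<omega>) - c * (t - s)"
proof -
  have "(\<Sum>i\<in>E. traffic Q i s t \<omega>) = (\<Sum>i\<in>E. traffic Q i 0 t \<omega> - traffic Q i 0 s \<omega>)"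
    using assms by (intro sum.cong refl traffic_split) auto
  then show ?thesis
    by (simp add: net_input_def sum_subtractf)
qed

lemma extremal_bdd_above:
  assumes E: "E \<subseteq> flows Q" and w: "\<omega> \<in> space (sample Q)"
  shows "bdd_above ((\<lambda>s. \<sigma> * net_input E c s t \<omega>) ` {0..t})"
proof (rule bdd_aboveI2)
  fix s assume s: "s \<in> {0..t}"
  let ?T = "\<lambda>s t. \<Sum>i\<in>E. traffic Q i s t \<omega>"
  have *: "0 \<le> ?T s t" "0 \<le> ?T 0 s"
    using E w s by (auto intro!: sum_nonneg traffic_nonneg)
  moreover have "?T s t = ?T 0 t - ?T 0 s"
    using net_input_split[OF E w, of s t 0] s by (simp add: net_input_def)
  moreover have "\<bar>c * (t - s)\<bar> \<le> \<bar>c\<bar> * t"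
    using s by (auto simp: abs_mult intro!: mult_left_mono)
  ultimately have "\<bar>net_input E c s t \<omega>\<bar> \<le> ?T 0 t + \<bar>c\<bar> * t"
    unfolding net_input_def by linarith
  then have "\<bar>\<sigma> * net_input E c s t \<omega>\<bar> \<le> \<bar>\<sigma>\<bar> * (?T 0 t + \<bar>c\<bar> * t)"
    unfolding abs_mult by (intro mult_left_mono) auto
  then show "\<sigma> * net_input E c s t \<omega> \<le> \<bar>\<sigma>\<bar> * (?T 0 t + \<bar>c\<bar> * t)"
    by linarith
qed

lemma extremal_gt_iff:
  assumes "E \<subseteq> flows Q" "\<omega> \<in> space (sample Q)" "0 \<le> t"
  shows "x < extremal \<sigma> E c t \<omega> \<longleftrightarrow> (\<exists>s\<in>{0..t}. x < \<sigma> * net_input E c s t \<omega>)"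
  unfolding extremal_def
  using assms by (intro less_cSUP_iff extremal_bdd_above) auto

text \<open>Paths are right continuous in $s$, so a strict excess at a time $s < t$ persists at rational times
shortly after $s$. The end point $t$, which may be irrational, has no later times in the interval and
is listed separately. The supremum over an uncountable set of times is thereby expressed by countably
many traffic variables, which makes it measurable and, further below, a function of the paths of the
flows involved.\<close>

lemma extremal_gt_iff_countable:
  assumes E: "E \<subseteq> flows Q" and w: "\<omega> \<in> space (sample Q)" and t: "0 \<le> t"
  shows "x < extremal \<sigma> E c t \<omega> \<longleftrightarrow> (\<exists>s\<in>insert t (\<rat> \<inter> {0..t}). x < \<sigma> * net_input E c s t \<omega>)"
proof
  assume "x < extremal \<sigma> E c t \<omega>"
  then obtain s where s: "0 \<le> s" "s \<le> t" "x < \<sigma> * net_input E c s t \<omega>"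
    using extremal_gt_iff[OF assms] by auto
  show "\<exists>s\<in>insert t (\<rat> \<inter> {0..t}). x < \<sigma> * net_input E c s t \<omega>"
  proof (cases "s = t")
    case True
    then show ?thesis using s by auto
  next
    case False
    let ?g = "\<lambda>s. (\<Sum>i\<in>E. traffic Q i 0 t \<omega>) - (\<Sum>i\<in>E. traffic Q i 0 s \<omega>) - c * (t - s)"
    have "((\<lambda>v. traffic Q i 0 v \<omega>) \<longlongrightarrow> traffic Q i 0 s \<omega>) (at_right s)" if "i \<in> E" for i
      using traffic_right_continuous[of i \<omega> s] that E w s unfolding continuous_within by auto
    then have "((\<lambda>s. \<sigma> * ?g s) \<longlongrightarrow> \<sigma> * ?g s) (at_right s)"
      by (intro tendsto_intros) auto
    moreover have "x < \<sigma> * ?g s"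
      using s net_input_split[OF E w, of s t c] by simp
    ultimately have "\<forall>\<^sub>F v in at_right s. x < \<sigma> * ?g v"
      by (rule order_tendstoD)
    then obtain b where b: "s < b" "\<And>v. s < v \<Longrightarrow> v < b \<Longrightarrow> x < \<sigma> * ?g v"
      unfolding eventually_at_right_field by blast
    obtain q where q: "q \<in> \<rat>" "s < q" "q < min b t"
      using Rats_dense_in_real[of s "min b t"] b(1) False s by auto
    then have "x < \<sigma> * net_input E c q t \<omega>"
      using b(2)[of q] net_input_split[OF E w, of q t c] s by simp
    then show ?thesis
      using q s by (intro bexI[of _ q]) auto
  qed
next
  assume "\<exists>s\<in>insert t (\<rat> \<inter> {0..t}). x < \<sigma> * net_input E c s t \<omega>"
  then show "x < extremal \<sigma> E c t \<omega>"
    using extremal_gt_iff[OF assms] t by auto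
qed

section \<open>Independence of disjoint sets of flows\<close>

text \<open>The independent components of the model are the joint light-tailed traffic and each heavy-tailed flow.
A set of flows has its own collection of independent components, disjoint from those of other such
sets, when it does not cut through the light-tailed flows.\<close>

definition block :: "'i \<Rightarrow> 'i set" where
  "block i = (if i \<in> light Q then light Q else {i})"

definition blocks :: "'i set \<Rightarrow> 'i set set" where
  "blocks E = block ` E"

definition union_of_blocks :: "'i set \<Rightarrow> bool" where
  "union_of_blocks E \<longleftrightarrow> E \<subseteq> flows Q \<and> (light Q \<subseteq> E \<or> light Q \<inter> E = {})"

abbreviation path_space :: "'i set \<Rightarrow> ('i \<times> real \<times> real \<Rightarrow> real) measure" where
  "path_space B \<equiv> PiM (B \<times> {(s, t). 0 \<le> s \<and> s \<le> t}) (\<lambda>_. borel)"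

abbreviation path_of :: "'i set \<Rightarrow> 'a \<Rightarrow> 'i \<times> real \<times> real \<Rightarrow> real" where
  "path_of B \<omega> \<equiv> \<lambda>(i, s, t)\<in>B \<times> {(s, t). 0 \<le> s \<and> s \<le> t}. traffic Q i s t \<omega>"

lemma block_eqD: "block i = block j \<Longrightarrow> i = j \<or> i \<in> light Q \<and> j \<in> light Q"
  by (cases "i \<in> light Q"; cases "j \<in> light Q") (simp_all add: block_def, blast+)

lemma blocks_disjoint:
  assumes "union_of_blocks E" "union_of_blocks E'" "E \<inter> E' = {}"
  shows "blocks E \<inter> blocks E' = {}"
proof (rule ccontr)
  assume "\<not> ?thesis"
  then obtain i j where ij: "i \<in> E" "j \<in> E'" "block i = block j"
    unfolding blocks_def by blast
  with assms(3) have "i \<in> light Q" "j \<in> light Q"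
    using block_eqD[OF ij(3)] by blast+
  with assms ij show False
    unfolding union_of_blocks_def by blast
qed

lemma blocks_subset: "E \<subseteq> flows Q \<Longrightarrow> blocks E \<subseteq> insert (light Q) ((\<lambda>i. {i}) ` heavy Q)"
  by (auto simp: blocks_def block_def flows_def)

text \<open>The event that the extremal value exceeds $x$, as a subset of the space of paths of the components of
$E$ instead of the sample space.\<close>

definition exceed_set :: "real \<Rightarrow> 'i set \<Rightarrow> real \<Rightarrow> real \<Rightarrow> real \<Rightarrow> ('i set \<Rightarrow> 'i \<times> real \<times> real \<Rightarrow> real) set"
  where
  "exceed_set \<sigma> E c t x = {p \<in> space (PiM (blocks E) path_space).
     \<exists>s\<in>insert t (\<rat> \<inter> {0..t}). x < \<sigma> * ((\<Sum>i\<in>E. p (block i) (i, s, t)) - c * (t - s))}"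

lemma exceed_set_measurable:
  assumes "union_of_blocks E" "0 \<le> t"
  shows "exceed_set \<sigma> E c t x \<in> sets (PiM (blocks E) path_space)"
proof -
  let ?D = "insert t (\<rat> \<inter> {0..t})"
  have D: "countable ?D"
    using countable_rat by (auto intro: countable_subset[of "\<rat> \<inter> {0..t}" "\<rat>"])
  have m: "(\<lambda>p. p (block i) (i, s, t)) \<in> borel_measurable (PiM (blocks E) path_space)"
    if "i \<in> E" "s \<in> ?D" for i s
  proof -
    have "(\<lambda>p. p (block i)) \<in> PiM (blocks E) path_space \<rightarrow>\<^sub>M path_space (block i)"
      by (intro measurable_component_singleton) (use that in \<open>auto simp: blocks_def\<close>)
    moreover have "(\<lambda>q. q (i, s, t)) \<in> path_space (block i) \<rightarrow>\<^sub>M borel"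
      using that assms(2) by (intro measurable_component_singleton) (auto simp: block_def)
    ultimately show ?thesis
      by (rule measurable_compose)
  qed
  have eq: "exceed_set \<sigma> E c t x = (\<Union>s\<in>?D. {p \<in> space (PiM (blocks E) path_space).
      x < \<sigma> * ((\<Sum>i\<in>E. p (block i) (i, s, t)) - c * (t - s))})"
    unfolding exceed_set_def by blast
  show ?thesis
    unfolding eq
  proof (rule sets.countable_UN''[OF D])
    fix s assume s: "s \<in> ?D"
    note [measurable] = m[OF _ s]
    show "{p \<in> space (PiM (blocks E) path_space).
        x < \<sigma> * ((\<Sum>i\<in>E. p (block i) (i, s, t)) - c * (t - s))} \<in> sets (PiM (blocks E) path_space)"
      by measurable
  qed
qed

lemma indep_paths:
  assumes K: "\<And>E. E \<in> K \<Longrightarrow> union_of_blocks E" and dis: "disjoint K"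
  shows "prob_space.indep_vars (sample Q) (\<lambda>E. PiM (blocks E) path_space)
    (\<lambda>E \<omega>. \<lambda>B\<in>blocks E. path_of B \<omega>) K"
proof -
  interpret prob_space "sample Q"
    by (rule prob)
  show ?thesis
  proof (rule indep_vars_restrict[OF independent[unfolded independent_flows_def]])
    show "blocks E \<subseteq> insert (light Q) ((\<lambda>i. {i}) ` heavy Q)" if "E \<in> K" for E
      using K[OF that] by (intro blocks_subset) (simp add: union_of_blocks_def)
    show "disjoint_family_on blocks K"
      unfolding disjoint_family_on_def
      using K dis blocks_disjoint by (metis disjointD)
  qed
qed

lemma extremal_gt_iff_path:
  assumes E: "union_of_blocks E" and w: "\<omega> \<in> space (sample Q)" and t: "0 \<le> t"
  shows "x < extremal \<sigma> E c t \<omega> \<longleftrightarrow> (\<lambda>B\<in>blocks E. path_of B \<omega>) \<in> exceed_set \<sigma> E c t x"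
proof -
  have E': "E \<subseteq> flows Q"
    using E by (simp add: union_of_blocks_def)
  have "(\<Sum>i\<in>E. (\<lambda>B\<in>blocks E. path_of B \<omega>) (block i) (i, s, t)) = (\<Sum>i\<in>E. traffic Q i s t \<omega>)"
    if "s \<in> insert t (\<rat> \<inter> {0..t})" for s
    using that t by (intro sum.cong refl) (auto simp: blocks_def block_def)
  moreover have "(\<lambda>B\<in>blocks E. path_of B \<omega>) \<in> space (PiM (blocks E) path_space)"
    by (auto simp: space_PiM)
  ultimately show ?thesis
    unfolding extremal_gt_iff_countable[OF E' w t] exceed_set_def net_input_def by auto
qed

lemma extremal_measurable:
  assumes E: "union_of_blocks E" and t: "0 \<le> t"
  shows "extremal \<sigma> E c t \<in> borel_measurable (sample Q)"
proof (rule borel_measurableI_greater)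
  interpret prob_space "sample Q"
    by (rule prob)
  fix x
  have "(\<lambda>\<omega>. \<lambda>B\<in>blocks E. path_of B \<omega>) \<in> sample Q \<rightarrow>\<^sub>M PiM (blocks E) path_space"
    using indep_paths[of "{E}"] E by (auto simp: indep_vars_def)
  from measurable_sets[OF this exceed_set_measurable[OF E t, of \<sigma> c x]]
  show "{\<omega> \<in> space (sample Q). x < extremal \<sigma> E c t \<omega>} \<in> sets (sample Q)"
    by (rule back_subst[of "\<lambda>A. A \<in> sets (sample Q)"])
      (use extremal_gt_iff_path[OF E _ t] in auto)
qed

text \<open>The extremal value over $E$ depends only on the paths of the components of $E$, and disjoint sets have
disjoint components, whence grouping independent components gives the product rule.\<close>

lemma extremal_indep:
  assumes K: "finite K" "K \<noteq> {}" "\<And>E. E \<in> K \<Longrightarrow> union_of_blocks E" "disjoint K" and t: "0 \<le> t"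
  shows "measure (sample Q) {\<omega> \<in> space (sample Q). \<forall>E\<in>K. x E < extremal (\<sigma> E) E (c E) t \<omega>} =
    (\<Prod>E\<in>K. measure (sample Q) {\<omega> \<in> space (sample Q). x E < extremal (\<sigma> E) E (c E) t \<omega>})"
proof -
  interpret prob_space "sample Q"
    by (rule prob)
  let ?X = "\<lambda>E \<omega>. \<lambda>B\<in>blocks E. path_of B \<omega>"
  let ?H = "\<lambda>E. exceed_set (\<sigma> E) E (c E) t (x E)"
  have eq: "{\<omega> \<in> space (sample Q). x E < extremal (\<sigma> E) E (c E) t \<omega>} = ?X E -` ?H E \<inter> space (sample Q)"
    if "E \<in> K" for E
    using extremal_gt_iff_path[OF K(3)[OF that] _ t] by auto
  have "prob (\<Inter>E\<in>K. ?X E -` ?H E \<inter> space (sample Q)) = (\<Prod>E\<in>K. prob (?X E -` ?H E \<inter> space (sample Q)))"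
    by (rule indep_varsD[OF indep_paths[of K]]) (use K t exceed_set_measurable in auto)
  moreover have "{\<omega> \<in> space (sample Q). \<forall>E\<in>K. x E < extremal (\<sigma> E) E (c E) t \<omega>} =
      (\<Inter>E\<in>K. {\<omega> \<in> space (sample Q). x E < extremal (\<sigma> E) E (c E) t \<omega>})"
    using K(2) by auto
  ultimately show ?thesis
    using eq by simp
qed

section \<open>Sample-path comparisons\<close>

lemma workload_gt_iff:
  assumes "E \<subseteq> flows Q" "\<omega> \<in> space (sample Q)" "0 \<le> t"
  shows "x < workload Q E c t \<omega> \<longleftrightarrow> (\<exists>s\<in>{0..t}. x < net_input E c s t \<omega>)"
  using extremal_gt_iff[OF assms, of x 1] by (simp add: workload_eq_extremal)

lemma net_input_le_workload:
  assumes "E \<subseteq> flows Q" "\<omega> \<in> space (sample Q)" "s \<in> {0..t}"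
  shows "net_input E c s t \<omega> \<le> workload Q E c t \<omega>"
  using workload_gt_iff[OF assms(1,2), of t "workload Q E c t \<omega>" c] assms(3) by force

lemma neg_net_input_le_deficit:
  assumes "E \<subseteq> flows Q" "\<omega> \<in> space (sample Q)" "s \<in> {0..t}"
  shows "- net_input E c s t \<omega> \<le> deficit Q E c t \<omega>"
  using extremal_gt_iff[OF assms(1,2), of t "deficit Q E c t \<omega>" "- 1" c] assms(3)
  by (force simp: deficit_eq_extremal)

lemma rho_Un: "E \<subseteq> flows Q \<Longrightarrow> F \<subseteq> flows Q \<Longrightarrow> E \<inter> F = {} \<Longrightarrow> rho Q (E \<union> F) = rho Q E + rho Q F"
  unfolding rho_def by (intro sum.union_disjoint finite_subset_flows)

lemma net_input_Un:
  assumes "E \<subseteq> flows Q" "F \<subseteq> flows Q" "E \<inter> F = {}"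
  shows "net_input (E \<union> F) (c + d) s t \<omega> = net_input E c s t \<omega> + net_input F d s t \<omega>"
  unfolding net_input_def using assms
  by (subst sum.union_disjoint) (auto simp: finite_subset_flows algebra_simps)

lemma net_input_sum:
  assumes "finite E"
  shows "(\<Sum>j\<in>E. net_input {j} (c j) s t \<omega>) = net_input E (\<Sum>j\<in>E. c j) s t \<omega>"
  unfolding net_input_def by (simp add: sum_subtractf sum_distrib_right)

lemma net_input_le_peak:
  assumes "J \<subseteq> heavy Q" "\<omega> \<in> space (sample Q)" "s \<in> {0..t}"
  shows "net_input J c s t \<omega> \<le> ((\<Sum>j\<in>J. peak_rate Q j) - c) * (t - s)"
proof -
  have "(\<Sum>j\<in>J. traffic Q j s t \<omega>) \<le> (\<Sum>j\<in>J. peak_rate Q j * (t - s))"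
  proof (rule sum_mono)
    fix j assume "j \<in> J"
    then have "heavy_flow Q j"
      using assms heavy_flows by blast
    then show "traffic Q j s t \<omega> \<le> peak_rate Q j * (t - s)"
      unfolding heavy_flow_def using assms by (intro on_off_flow_le_peak) auto
  qed
  then show ?thesis
    unfolding net_input_def by (simp add: algebra_simps sum_distrib_left)
qed

lemma rho_remainder: "S \<subseteq> flows Q \<Longrightarrow> rho Q (flows Q - S) = rho Q (flows Q) - rho Q S"
  using rho_Un[of S "flows Q - S"] by (simp add: Un_absorb1)

lemma cap_eq: "S \<subseteq> flows Q \<Longrightarrow> cap Q S = 1 - rho Q (flows Q) + rho Q S"
  by (simp add: cap_def rho_remainder)

lemma net_input_flows:
  assumes "S \<subseteq> flows Q"
  shows "net_input (flows Q) 1 s t \<omega> =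
    net_input S (cap Q S + \<delta>) s t \<omega> + net_input (flows Q - S) (rho Q (flows Q - S) - \<delta>) s t \<omega>"
  using net_input_Un[of S "flows Q - S" "cap Q S + \<delta>" "rho Q (flows Q - S) - \<delta>" s t \<omega>] assms
  by (simp add: Un_absorb1 cap_def)

text \<open>The remaining flows receive $\delta$ more than their mean rate, which leaves $c_S - \delta$ for $S$. At
a time $s$ where the total net input exceeds $x$, the two net inputs add up to it.\<close>

lemma workload_reduced_upper:
  assumes S: "S \<subseteq> flows Q" and w: "\<omega> \<in> space (sample Q)" and t: "0 \<le> t"
    and x: "x < workload Q (flows Q) 1 t \<omega>"
    and y: "workload Q (flows Q - S) (rho Q (flows Q - S) + \<delta>) t \<omega> \<le> y"
  shows "x - y < workload Q S (cap Q S - \<delta>) t \<omega>"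
proof -
  obtain s where s: "s \<in> {0..t}" "x < net_input (flows Q) 1 s t \<omega>"
    using workload_gt_iff[OF _ w t] x by auto
  moreover have "net_input (flows Q - S) (rho Q (flows Q - S) + \<delta>) s t \<omega> \<le> y"
    using net_input_le_workload[OF _ w s(1), of "flows Q - S"] y by (meson Diff_subset order_trans)
  ultimately have "x - y < net_input S (cap Q S - \<delta>) s t \<omega>"
    using net_input_flows[OF S, of s t \<omega> "- \<delta>"] by simp
  then show ?thesis
    using workload_gt_iff[OF S w t] s(1) by blast
qed

text \<open>Here the remaining flows are credited with $\delta$ less than their mean rate, and the deficit bounds
how far they fall short of that.\<close>

lemma workload_reduced_lower:
  assumes S: "S \<subseteq> flows Q" and w: "\<omega> \<in> space (sample Q)" and t: "0 \<le> t"
    and x: "x + y < workload Q S (cap Q S + \<delta>) t \<omega>"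
    and y: "deficit Q (flows Q - S) (rho Q (flows Q - S) - \<delta>) t \<omega> \<le> y"
  shows "x < workload Q (flows Q) 1 t \<omega>"
proof -
  obtain s where s: "s \<in> {0..t}" "x + y < net_input S (cap Q S + \<delta>) s t \<omega>"
    using workload_gt_iff[OF S w t] x by auto
  moreover have "- net_input (flows Q - S) (rho Q (flows Q - S) - \<delta>) s t \<omega> \<le> y"
    using neg_net_input_le_deficit[OF _ w s(1), of "flows Q - S"] y by (meson Diff_subset order_trans)
  ultimately have "x < net_input (flows Q) 1 s t \<omega>"
    using net_input_flows[OF S, of s t \<omega> "\<delta>"] by simp
  then show ?thesis
    using workload_gt_iff[OF _ w t] s(1) by blast
qed

text \<open>If $J$ is not critical then its flows together, even when all of them are On, leave spare capacity
$-d_J$. The margin makes $\varepsilon$ so small that the other flows (at most $N$ of them) and the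
light-tailed aggregate can each be served at $\varepsilon$ above the mean rate out of this spare
capacity.\<close>

definition noncritical_margin :: "real \<Rightarrow> bool" where
  "noncritical_margin \<epsilon> \<longleftrightarrow> 0 < \<epsilon> \<and>
     (\<forall>J\<subseteq>heavy Q. \<not> critical Q J \<longrightarrow> (real (card (flows Q)) + 1) * \<epsilon> \<le> - drift Q J)"

lemma heavy_subset_flows: "heavy Q \<subseteq> flows Q"
  by (simp add: flows_def)

lemma finite_heavy: "finite (heavy Q)"
  using heavy_subset_flows by (rule finite_subset_flows)

lemma not_critical_empty: "\<not> critical Q {}"
  using stability by (simp add: critical_def drift_def cap_def)

lemma noncritical_margin_exists: "\<exists>\<epsilon>. noncritical_margin \<epsilon>"
proof -
  let ?N = "real (card (flows Q))"
  define A where "A = (\<lambda>J. - drift Q J / (?N + 1)) ` {J. J \<subseteq> heavy Q \<and> \<not> critical Q J}"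
  have "finite A" "A \<noteq> {}"
    using finite_heavy not_critical_empty by (auto simp: A_def)
  moreover have "\<forall>a\<in>A. 0 < a"
    by (auto simp: A_def critical_def intro!: divide_neg_pos)
  ultimately have "0 < Min A" "\<forall>a\<in>A. Min A \<le> a"
    by auto
  then show ?thesis
    unfolding noncritical_margin_def
    by (intro exI[of _ "Min A"]) (auto simp: A_def field_simps)
qed

lemma noncritical_marginD:
  assumes "noncritical_margin \<epsilon>" "J \<subseteq> heavy Q" "\<not> critical Q J" "a \<le> real (card (flows Q)) + 1"
  shows "a * \<epsilon> \<le> - drift Q J"
proof -
  have "a * \<epsilon> \<le> (real (card (flows Q)) + 1) * \<epsilon>"
    using assms by (intro mult_right_mono) (auto simp: noncritical_margin_def)
  also have "\<dots> \<le> - drift Q J"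
    using assms(1-3) by (simp add: noncritical_margin_def)
  finally show ?thesis .
qed

lemma minimally_critical_in:
  assumes "critical Q J"
  obtains E where "E \<subseteq> J" "minimally_critical Q E"
proof -
  have "finite {E. E \<subseteq> J \<and> critical Q E}"
    using assms finite_subset[OF _ finite_heavy, of J] by (auto simp: critical_def)
  moreover have "{E. E \<subseteq> J \<and> critical Q E} \<noteq> {}"
    using assms by auto
  ultimately obtain E where E: "E \<subseteq> J" "critical Q E"
    "\<And>U. U \<subseteq> J \<Longrightarrow> critical Q U \<Longrightarrow> U \<subseteq> E \<Longrightarrow> E = U"
    using finite_has_minimal[of "{E. E \<subseteq> J \<and> critical Q E}"] by auto
  have "\<not> critical Q U" if "U \<subset> E" for U
    using E(3)[of U] that E(1) by blast
  with E(1,2) that show ?thesis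
    unfolding minimally_critical_def by blast
qed

text \<open>Let $J$ be the heavy-tailed flows whose individual workload exceeds $x / N$. If $J$ were not critical,
then it would contribute no net input at the rate that remains when the other flows are served at
$\varepsilon$ above their means; the other heavy-tailed flows and the light-tailed aggregate contribute
at most $x / N$ each, which together is at most $x$. So $J$ is critical and contains a minimally critical set.\<close>

lemma overflow_needs_minimally_critical_set:
  assumes \<epsilon>: "noncritical_margin \<epsilon>" and w: "\<omega> \<in> space (sample Q)" and t: "0 \<le> t" and x: "0 < x"
    and over: "x < workload Q (flows Q) 1 t \<omega>"
    and light: "workload Q (light Q) (rho Q (light Q) + \<epsilon>) t \<omega> \<le> x / real (card (flows Q))"
  obtains E where "minimally_critical Q E"
    "\<And>j. j \<in> E \<Longrightarrow> x / real (card (flows Q)) < workload Q {j} (intensity Q j + \<epsilon>) t \<omega>"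
proof -
  let ?N = "real (card (flows Q))"
  define J where "J = {j \<in> heavy Q. x / ?N < workload Q {j} (intensity Q j + \<epsilon>) t \<omega>}"
  define H where "H = heavy Q - J"
  have sub: "J \<subseteq> flows Q" "H \<subseteq> flows Q" "light Q \<subseteq> flows Q" and fin: "finite H" "finite (light Q)"
    using finite_heavy finite_flows by (auto simp: J_def H_def flows_def)
  have dis: "light Q \<inter> H = {}" "J \<inter> (light Q \<union> H) = {}" and un: "J \<union> (light Q \<union> H) = flows Q"
    using disjoint_flows by (auto simp: J_def H_def flows_def)
  have card: "card (light Q) + card H \<le> card (flows Q)"
    using card_mono[OF finite_flows, of "light Q \<union> H"] sub dis(1) fin
    by (simp add: card_Un_disjoint)
  have "critical Q J"
  proof (rule ccontr)
    assume nc: "\<not> critical Q J"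
    obtain s where s: "s \<in> {0..t}" "x < net_input (flows Q) 1 s t \<omega>"
      using workload_gt_iff[OF _ w t] over by auto
    define a where "a = (real (card H) + 1) * \<epsilon>"
    have "a \<le> - drift Q J"
      unfolding a_def using card nc
      by (intro noncritical_marginD[OF \<epsilon>]) (auto simp: J_def)
    then have "((\<Sum>j\<in>J. peak_rate Q j) - (cap Q J - a)) * (t - s) \<le> 0"
      using s(1) by (intro mult_nonpos_nonneg) (auto simp: drift_def)
    then have netJ: "net_input J (cap Q J - a) s t \<omega> \<le> 0"
      using net_input_le_peak[of J \<omega> s t "cap Q J - a"] w s(1) by (auto simp: J_def)
    have "net_input H (\<Sum>j\<in>H. intensity Q j + \<epsilon>) s t \<omega> \<le> (\<Sum>j\<in>H. x / ?N)"
      unfolding net_input_sum[OF fin(1), symmetric]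
    proof (rule sum_mono)
      fix j assume j: "j \<in> H"
      have "net_input {j} (intensity Q j + \<epsilon>) s t \<omega> \<le> workload Q {j} (intensity Q j + \<epsilon>) t \<omega>"
        using j sub w s(1) by (intro net_input_le_workload) auto
      then show "net_input {j} (intensity Q j + \<epsilon>) s t \<omega> \<le> x / ?N"
        using j by (auto simp: H_def J_def)
    qed
    then have netH: "net_input H (rho Q H + real (card H) * \<epsilon>) s t \<omega> \<le> real (card H) * (x / ?N)"
      by (simp add: rho_def sum.distrib)
    \<comment> \<open>There are only $N$ shares $x / N$, so an empty light-tailed aggregate must not use one up.\<close>
    have netL: "net_input (light Q) (rho Q (light Q) + \<epsilon>) s t \<omega> \<le> real (card (light Q)) * (x / ?N)"
    proof (cases "light Q = {}")
      case True
      then show ?thesis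
        using \<epsilon> s(1) by (auto simp: net_input_def rho_def noncritical_margin_def)
    next
      case False
      then have "1 \<le> real (card (light Q))"
        using fin(2) by (simp add: Suc_le_eq card_gt_0_iff)
      then have "1 * (x / ?N) \<le> real (card (light Q)) * (x / ?N)"
        using x by (intro mult_right_mono) auto
      then show ?thesis
        using net_input_le_workload[OF sub(3) w s(1), of "rho Q (light Q) + \<epsilon>"] light by simp
    qed
    have rest: "flows Q - J = light Q \<union> H"
      using un dis(2) by blast
    have "net_input (flows Q) 1 s t \<omega> = net_input J (cap Q J - a) s t \<omega> +
        net_input (light Q \<union> H) (rho Q (light Q \<union> H) + a) s t \<omega>"
      using net_input_flows[OF sub(1), of s t \<omega> "- a"]
      unfolding rest by simp
    also have "net_input (light Q \<union> H) (rho Q (light Q \<union> H) + a) s t \<omega> =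
        net_input (light Q) (rho Q (light Q) + \<epsilon>) s t \<omega> + net_input H (rho Q H + real (card H) * \<epsilon>) s t \<omega>"
      unfolding net_input_Un[OF sub(3,2) dis(1), symmetric] rho_Un[OF sub(3,2) dis(1)] a_def
      by (simp add: algebra_simps)
    finally have "x < (real (card (light Q)) + real (card H)) * (x / ?N)"
      using s(2) netJ netH netL by (simp add: algebra_simps)
    also have "\<dots> \<le> ?N * (x / ?N)"
      using card x by (intro mult_right_mono) auto
    also have "\<dots> \<le> x"
      using x by simp
    finally show False
      by simp
  qed
  then obtain E where "E \<subseteq> J" "minimally_critical Q E"
    by (rule minimally_critical_in)
  then show ?thesis
    using that by (auto simp: J_def)
qed

text \<open>Removing $j$ leaves a set that is not critical, hence unable to build up any workload even when all of
its flows are On. The whole excess of $S$ is then due to $j$. This holds for each $j \in S$, which is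
why two different dominant sets are unlikely to overflow together.\<close>

lemma minimally_critical_all_large:
  assumes S: "minimally_critical Q S" and \<epsilon>: "noncritical_margin \<epsilon>" and \<delta>: "0 \<le> \<delta>"
    and w: "\<omega> \<in> space (sample Q)" and t: "0 \<le> t" and j: "j \<in> S"
    and x: "x < workload Q S (cap Q S + \<delta>) t \<omega>"
  shows "x < workload Q {j} (intensity Q j + \<epsilon>) t \<omega>"
proof -
  have S': "S \<subseteq> heavy Q" "S \<subseteq> flows Q" and nc: "\<not> critical Q (S - {j})"
    using S j heavy_subset_flows by (auto simp: minimally_critical_def critical_def)
  obtain s where s: "s \<in> {0..t}" "x < net_input S (cap Q S + \<delta>) s t \<omega>"
    using workload_gt_iff[OF S'(2) w t] x by auto
  let ?c = "cap Q S + \<delta> - (intensity Q j + \<epsilon>)"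
  have "net_input S (cap Q S + \<delta>) s t \<omega> =
      net_input {j} (intensity Q j + \<epsilon>) s t \<omega> + net_input (S - {j}) ?c s t \<omega>"
    using net_input_Un[of "{j}" "S - {j}" "intensity Q j + \<epsilon>" ?c s t \<omega>] j S'
    by (simp add: insert_absorb subset_iff)
  moreover have "net_input (S - {j}) ?c s t \<omega> \<le> 0"
  proof -
    have "rho Q S = rho Q {j} + rho Q (S - {j})"
      using rho_Un[of "{j}" "S - {j}"] j S' by (simp add: insert_absorb subset_iff)
    then have "cap Q (S - {j}) = cap Q S - intensity Q j"
      using cap_eq[OF S'(2)] cap_eq[OF subset_trans[OF Diff_subset S'(2)]] by (simp add: rho_def)
    moreover have "1 * \<epsilon> \<le> - drift Q (S - {j})"
      using S' by (intro noncritical_marginD[OF \<epsilon> _ nc]) auto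
    ultimately have "((\<Sum>i\<in>S - {j}. peak_rate Q i) - ?c) * (t - s) \<le> 0"
      using s(1) \<delta> by (intro mult_nonpos_nonneg) (auto simp: drift_def)
    then show ?thesis
      using net_input_le_peak[of "S - {j}" \<omega> s t ?c] S' w s(1) by (meson Diff_subset order_trans)
  qed
  ultimately have "x < net_input {j} (intensity Q j + \<epsilon>) s t \<omega>"
    using s(2) by simp
  then show ?thesis
    using workload_gt_iff[OF _ w t, of "{j}"] j S' s(1) by blast
qed

text \<open>Since $\nu_j > 1$, dropping flows strictly decreases $\mu_S$, so a critical proper subset would
contradict the minimality of $\mu_S$.\<close>

lemma weakly_dominant_minimally_critical:
  assumes S: "weakly_dominant Q S"
  shows "minimally_critical Q S"
  unfolding minimally_critical_def
proof (intro conjI allI impI notI)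
  show "critical Q S"
    using S by (auto simp: weakly_dominant_def strictly_critical_def critical_def)
  fix U assume U: "U \<subset> S" "critical Q U"
  have Sh: "S \<subseteq> heavy Q" and fin: "finite S"
    using S finite_subset[OF _ finite_heavy] by (auto simp: weakly_dominant_def strictly_critical_def)
  obtain b where b: "b \<in> S - U"
    using U by blast
  have "decay Q U < decay Q S"
    unfolding decay_def
  proof (rule sum_strict_mono2[OF fin])
    have pos: "0 < tail_index Q j - 1" if "j \<in> S" for j
      using that Sh heavy_flows[of j] by (auto simp: heavy_flow_def)
    show "U \<subseteq> S" "b \<in> S - U" "0 < tail_index Q b - 1"
      using U b pos by auto
    show "\<And>x. x \<in> S \<Longrightarrow> 0 \<le> tail_index Q x - 1"
      using pos by force
  qed
  with S U show False
    unfolding weakly_dominant_def by force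
qed

section \<open>Bounds on the overflow probability at a finite time\<close>

definition overflow_prob :: "'i set \<Rightarrow> real \<Rightarrow> real \<Rightarrow> real \<Rightarrow> real" where
  "overflow_prob E c t x = measure (sample Q) {\<omega> \<in> space (sample Q). x < workload Q E c t \<omega>}"

lemma union_of_blocks_heavy: "S \<subseteq> heavy Q \<Longrightarrow> union_of_blocks S"
  using disjoint_flows by (auto simp: union_of_blocks_def flows_def)

lemma union_of_blocks_remainder: "S \<subseteq> heavy Q \<Longrightarrow> union_of_blocks (flows Q - S)"
  using disjoint_flows by (auto simp: union_of_blocks_def flows_def)

lemma union_of_blocks_light: "union_of_blocks (light Q)"
  by (auto simp: union_of_blocks_def flows_def)

lemma union_of_blocks_flows: "union_of_blocks (flows Q)"
  by (auto simp: union_of_blocks_def flows_def)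

lemma workload_measurable:
  "union_of_blocks E \<Longrightarrow> 0 \<le> t \<Longrightarrow> workload Q E c t \<in> borel_measurable (sample Q)"
  by (simp add: workload_eq_extremal extremal_measurable)

lemma deficit_measurable:
  "union_of_blocks E \<Longrightarrow> 0 \<le> t \<Longrightarrow> deficit Q E c t \<in> borel_measurable (sample Q)"
  by (simp add: deficit_eq_extremal extremal_measurable)

lemma workload_event:
  assumes "union_of_blocks E" "0 \<le> t"
  shows "{\<omega> \<in> space (sample Q). x < workload Q E c t \<omega>} \<in> sets (sample Q)"
proof -
  note [measurable] = workload_measurable[OF assms, of c]
  show ?thesis by measurable
qed

lemma deficit_event:
  assumes "union_of_blocks E" "0 \<le> t"
  shows "{\<omega> \<in> space (sample Q). x < deficit Q E c t \<omega>} \<in> sets (sample Q)"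
proof -
  note [measurable] = deficit_measurable[OF assms, of c]
  show ?thesis by measurable
qed

lemma limiting_law_V_law:
  assumes "E \<subseteq> flows Q" "rho Q E < c"
  shows "limiting_law (sample Q) (workload Q E c) (V_law Q E c)"
  unfolding V_law_def by (rule someI_ex) (rule workload_limit[OF assms])

lemma real_distribution_V_law:
  assumes "E \<subseteq> flows Q" "rho Q E < c"
  shows "real_distribution (V_law Q E c)"
  using limiting_law_V_law[OF assms] by (simp add: limiting_law_def)

lemma overflow_prob_tendsto:
  assumes "union_of_blocks E" "rho Q E < c" "measure (V_law Q E c) {x} = 0"
  shows "(\<lambda>n. overflow_prob E c (real n) x) \<longlonglongrightarrow> V_tail Q E c x"
  unfolding overflow_prob_def V_tail_def
  by (rule limiting_law_tail[OF prob limiting_law_V_law])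
    (use assms in \<open>auto simp: union_of_blocks_def intro!: workload_measurable\<close>)

lemma AE_overflow_prob_tendsto:
  assumes "union_of_blocks E" "rho Q E < c" "a \<noteq> 0"
  shows "AE x in lborel. (\<lambda>n. overflow_prob E c (real n) (a * x + b)) \<longlonglongrightarrow> V_tail Q E c (a * x + b)"
proof -
  have "AE x in lborel. measure (V_law Q E c) {a * x + b} = 0"
    using assms by (intro AE_atomless_affine real_distribution_V_law) (auto simp: union_of_blocks_def)
  then show ?thesis
    by eventually_elim (rule overflow_prob_tendsto[OF assms(1,2)])
qed

lemma V_tail_right_continuous:
  assumes "E \<subseteq> flows Q" "rho Q E < c" "0 < a"
  shows "((\<lambda>z. V_tail Q E c (a * z + b)) \<longlongrightarrow> V_tail Q E c (a * x + b)) (at_right x)"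
  unfolding V_tail_def
  by (rule tail_affine_right_continuous[OF real_distribution_V_law[OF assms(1,2)] assms(3)])

lemma V_tail_nonneg: "0 \<le> V_tail Q E c x"
  by (simp add: V_tail_def)

lemma V_tail_tendsto_0:
  assumes "E \<subseteq> flows Q" "rho Q E < c"
  shows "(V_tail Q E c \<longlongrightarrow> 0) at_top"
  using tail_tendsto_0[OF real_distribution_V_law[OF assms]]
  by (simp add: V_tail_def[abs_def])

lemma V_tail_antimono:
  assumes "E \<subseteq> flows Q" "rho Q E < c" "x \<le> y"
  shows "V_tail Q E c y \<le> V_tail Q E c x"
proof -
  interpret real_distribution "V_law Q E c"
    by (rule real_distribution_V_law[OF assms(1,2)])
  show ?thesis
    unfolding V_tail_def using assms(3) by (intro finite_measure_mono) auto
qed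

lemma prob_all_large:
  assumes S: "S \<subseteq> heavy Q" "S \<noteq> {}" and t: "0 \<le> t"
  shows "measure (sample Q) {\<omega> \<in> space (sample Q). \<forall>j\<in>S. x < workload Q {j} (c j) t \<omega>} =
    (\<Prod>j\<in>S. overflow_prob {j} (c j) t x)"
proof -
  let ?K = "(\<lambda>j. {j}) ` S"
  have "measure (sample Q) {\<omega> \<in> space (sample Q). \<forall>E\<in>?K. x < extremal 1 E (c (the_elem E)) t \<omega>} =
    (\<Prod>E\<in>?K. measure (sample Q) {\<omega> \<in> space (sample Q). x < extremal 1 E (c (the_elem E)) t \<omega>})"
    using S t finite_subset[OF S(1) finite_heavy]
    by (intro extremal_indep) (auto simp: disjoint_def intro!: union_of_blocks_heavy)
  then show ?thesis
    by (simp add: prod.reindex overflow_prob_def workload_eq_extremal)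
qed

lemma prob_all_large_and_remainder:
  assumes S: "S \<subseteq> heavy Q" "S \<noteq> {}" and t: "0 \<le> t"
  shows "measure (sample Q) {\<omega> \<in> space (sample Q).
      (\<forall>j\<in>S. x < workload Q {j} (c j) t \<omega>) \<and> y < workload Q (flows Q - S) d t \<omega>} =
    (\<Prod>j\<in>S. overflow_prob {j} (c j) t x) * overflow_prob (flows Q - S) d t y"
proof -
  let ?R = "flows Q - S"
  let ?K = "(\<lambda>j. {j}) ` S"
  let ?x = "\<lambda>E. if E = ?R then y else x"
  let ?c = "\<lambda>E. if E = ?R then d else c (the_elem E)"
  have R: "{j} \<noteq> ?R" if "j \<in> S" for j
    using that by auto
  then have R': "?R \<notin> ?K"
    by auto
  have "measure (sample Q) {\<omega> \<in> space (sample Q). \<forall>E\<in>insert ?R ?K. ?x E < extremal 1 E (?c E) t \<omega>} =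
    (\<Prod>E\<in>insert ?R ?K. measure (sample Q) {\<omega> \<in> space (sample Q). ?x E < extremal 1 E (?c E) t \<omega>})"
  proof (rule extremal_indep)
    show "finite (insert ?R ?K)"
      using finite_subset[OF S(1) finite_heavy] by simp
    show "union_of_blocks E" if "E \<in> insert ?R ?K" for E
      using that union_of_blocks_remainder[OF S(1)] S(1)
      by (auto simp del: insert_subset intro: union_of_blocks_heavy)
    show "disjoint (insert ?R ?K)"
      unfolding disjoint_def by blast
  qed (use t in auto)
  moreover have "(\<Prod>E\<in>?K. measure (sample Q) {\<omega> \<in> space (sample Q). ?x E < extremal 1 E (?c E) t \<omega>}) =
      (\<Prod>j\<in>S. overflow_prob {j} (c j) t x)"
    using R by (simp add: prod.reindex overflow_prob_def workload_eq_extremal)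
  moreover have "(\<forall>E\<in>?K. ?x E < extremal 1 E (?c E) t \<omega>) \<longleftrightarrow> (\<forall>j\<in>S. x < workload Q {j} (c j) t \<omega>)" for \<omega>
    using R by (simp add: workload_eq_extremal)
  ultimately show ?thesis
    using R' finite_subset[OF S(1) finite_heavy]
    by (simp add: overflow_prob_def workload_eq_extremal conj_commute mult.commute)
qed

lemma prob_workload_and_deficit:
  assumes S: "S \<subseteq> heavy Q" "S \<noteq> {}" and t: "0 \<le> t"
  shows "measure (sample Q) {\<omega> \<in> space (sample Q).
      x < workload Q S c t \<omega> \<and> y < deficit Q (flows Q - S) d t \<omega>} =
    overflow_prob S c t x *
    measure (sample Q) {\<omega> \<in> space (sample Q). y < deficit Q (flows Q - S) d t \<omega>}"
proof -
  let ?R = "flows Q - S"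
  let ?K = "{S, ?R}"
  let ?x = "\<lambda>E. if E = S then x else y"
  let ?c = "\<lambda>E. if E = S then c else d"
  let ?\<sigma> = "\<lambda>E. if E = S then 1 else - 1"
  have R: "?R \<noteq> S" "S \<noteq> ?R"
    using S by auto
  have "measure (sample Q) {\<omega> \<in> space (sample Q). \<forall>E\<in>?K. ?x E < extremal (?\<sigma> E) E (?c E) t \<omega>} =
    (\<Prod>E\<in>?K. measure (sample Q) {\<omega> \<in> space (sample Q). ?x E < extremal (?\<sigma> E) E (?c E) t \<omega>})"
    using S t union_of_blocks_remainder[OF S(1)] union_of_blocks_heavy[OF S(1)]
    by (intro extremal_indep) (auto simp: disjoint_def)
  then show ?thesis
    using R by (simp add: overflow_prob_def workload_eq_extremal deficit_eq_extremal)
qed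

abbreviation dominant_sets :: "'i set set" where
  "dominant_sets \<equiv> {S. weakly_dominant Q S}"

abbreviation minimal_sets :: "'i set set" where
  "minimal_sets \<equiv> {S. minimally_critical Q S}"

lemma minimal_sets_heavy: "E \<in> minimal_sets \<Longrightarrow> E \<subseteq> heavy Q \<and> E \<noteq> {}"
  using not_critical_empty by (auto simp: minimally_critical_def critical_def)

lemma dominant_sets_heavy: "S \<in> dominant_sets \<Longrightarrow> S \<subseteq> heavy Q \<and> S \<noteq> {}"
  using minimal_sets_heavy weakly_dominant_minimally_critical by blast

lemma finite_minimal_sets: "finite minimal_sets"
  using minimal_sets_heavy by (intro finite_subset[OF _ iffD2[OF finite_Pow_iff finite_heavy]]) auto

lemma finite_dominant_sets: "finite dominant_sets"
  using dominant_sets_heavy by (intro finite_subset[OF _ iffD2[OF finite_Pow_iff finite_heavy]]) auto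

text \<open>An overflow comes with a large light-tailed workload or with a minimally critical set of individually
large flows. When that set is a dominant $S$, the overflow is compared with that of $S$ alone as long
as the workload of the remaining flows stays below $y$; otherwise the large remaining workload is
independent of the large flows in $S$ and gives an additional small factor.\<close>

lemma overflow_prob_upper:
  assumes \<epsilon>: "noncritical_margin \<epsilon>" and t: "0 \<le> t" and x: "0 < x"
  defines "N \<equiv> real (card (flows Q))"
  shows "overflow_prob (flows Q) 1 t x \<le>
    overflow_prob (light Q) (rho Q (light Q) + \<epsilon>) t (x / N) +
    (\<Sum>E\<in>minimal_sets - dominant_sets. \<Prod>j\<in>E. overflow_prob {j} (intensity Q j + \<epsilon>) t (x / N)) +
    (\<Sum>S\<in>dominant_sets. overflow_prob S (cap Q S - \<delta>) t (x - y) +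
       (\<Prod>j\<in>S. overflow_prob {j} (intensity Q j + \<epsilon>) t (x / N)) *
       overflow_prob (flows Q - S) (rho Q (flows Q - S) + \<delta>) t y)"
proof -
  interpret prob_space "sample Q"
    by (rule prob)
  let ?sp = "space (sample Q)"
  define AL where "AL = {\<omega> \<in> ?sp. x / N < workload Q (light Q) (rho Q (light Q) + \<epsilon>) t \<omega>}"
  define B where "B E = {\<omega> \<in> ?sp. \<forall>j\<in>E. x / N < workload Q {j} (intensity Q j + \<epsilon>) t \<omega>}" for E
  define C where "C S = {\<omega> \<in> ?sp. x - y < workload Q S (cap Q S - \<delta>) t \<omega>}" for S
  define D where "D S = {\<omega> \<in> ?sp. (\<forall>j\<in>S. x / N < workload Q {j} (intensity Q j + \<epsilon>) t \<omega>) \<and>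
    y < workload Q (flows Q - S) (rho Q (flows Q - S) + \<delta>) t \<omega>}" for S
  let ?M = "minimal_sets - dominant_sets"
  have evAL: "AL \<in> events"
    unfolding AL_def using workload_event[OF union_of_blocks_light t] .
  have evB: "B E \<in> events" if "E \<in> minimal_sets" for E
    unfolding B_def
  proof (rule sets.sets_Collect_finite_All')
    show "finite E" "E \<noteq> {}"
      using minimal_sets_heavy[OF that] finite_subset[OF _ finite_heavy] by auto
    show "{\<omega> \<in> ?sp. x / N < workload Q {j} (intensity Q j + \<epsilon>) t \<omega>} \<in> events" if "j \<in> E" for j
      using minimal_sets_heavy[OF \<open>E \<in> minimal_sets\<close>] that t
      by (intro workload_event union_of_blocks_heavy) auto
  qed
  have evC: "C S \<in> events" if "S \<in> dominant_sets" for S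
    unfolding C_def using dominant_sets_heavy[OF that] t by (intro workload_event union_of_blocks_heavy) auto
  have evD: "D S \<in> events" if "S \<in> dominant_sets" for S
  proof -
    have "D S = B S \<inter> {\<omega> \<in> ?sp. y < workload Q (flows Q - S) (rho Q (flows Q - S) + \<delta>) t \<omega>}"
      by (auto simp: D_def B_def)
    then show ?thesis
      using evB[of S] that weakly_dominant_minimally_critical[of S] dominant_sets_heavy[OF that] t
        workload_event[OF union_of_blocks_remainder] by auto
  qed
  have sub: "{\<omega> \<in> ?sp. x < workload Q (flows Q) 1 t \<omega>} \<subseteq> AL \<union> (\<Union>E\<in>?M. B E) \<union> (\<Union>S\<in>dominant_sets. C S \<union> D S)"
  proof safe
    fix \<omega> assume w: "\<omega> \<in> ?sp" "x < workload Q (flows Q) 1 t \<omega>"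
      and nCD: "\<omega> \<notin> (\<Union>S\<in>dominant_sets. C S \<union> D S)" and nB: "\<omega> \<notin> (\<Union>E\<in>?M. B E)"
    show "\<omega> \<in> AL"
    proof (rule ccontr)
      assume "\<omega> \<notin> AL"
      then have "workload Q (light Q) (rho Q (light Q) + \<epsilon>) t \<omega> \<le> x / real (card (flows Q))"
        using w by (auto simp: AL_def N_def)
      from overflow_needs_minimally_critical_set[OF \<epsilon> w(1) t x w(2) this]
      obtain E where E: "minimally_critical Q E"
        "\<And>j. j \<in> E \<Longrightarrow> x / real (card (flows Q)) < workload Q {j} (intensity Q j + \<epsilon>) t \<omega>"
        by blast
      have "\<omega> \<in> B E"
        using E(2) w(1) by (simp add: B_def N_def)
      with nB E(1) have dom: "weakly_dominant Q E"
        by blast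
      then have "\<omega> \<notin> D E" "\<omega> \<notin> C E"
        using nCD by auto
      then have "workload Q (flows Q - E) (rho Q (flows Q - E) + \<delta>) t \<omega> \<le> y"
        using \<open>\<omega> \<in> B E\<close> by (auto simp: D_def B_def)
      then have "x - y < workload Q E (cap Q E - \<delta>) t \<omega>"
        using dominant_sets_heavy[of E] dom heavy_subset_flows w t
        by (intro workload_reduced_upper) auto
      with \<open>\<omega> \<notin> C E\<close> w show False
        by (simp add: C_def)
    qed
  qed
  have "overflow_prob (flows Q) 1 t x \<le> prob (AL \<union> (\<Union>E\<in>?M. B E) \<union> (\<Union>S\<in>dominant_sets. C S \<union> D S))"
    unfolding overflow_prob_def using evAL evB evC evD finite_minimal_sets finite_dominant_sets
    by (intro finite_measure_mono sub sets.Un sets.finite_UN) auto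
  also have "\<dots> \<le> prob AL + prob (\<Union>E\<in>?M. B E) + prob (\<Union>S\<in>dominant_sets. C S \<union> D S)"
    using evAL evB evC evD finite_minimal_sets finite_dominant_sets
    by (intro order_trans[OF measure_Un_le] add_mono measure_Un_le order_refl sets.Un sets.finite_UN) auto
  also have "\<dots> \<le> prob AL + (\<Sum>E\<in>?M. prob (B E)) + (\<Sum>S\<in>dominant_sets. prob (C S \<union> D S))"
    using evB evC evD finite_minimal_sets finite_dominant_sets
    by (intro add_mono order_refl finite_measure_subadditive_finite) auto
  also have "\<dots> \<le> prob AL + (\<Sum>E\<in>?M. prob (B E)) + (\<Sum>S\<in>dominant_sets. prob (C S) + prob (D S))"
    using evC evD by (intro add_mono order_refl sum_mono measure_Un_le) auto
  also have "prob AL = overflow_prob (light Q) (rho Q (light Q) + \<epsilon>) t (x / N)"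
    by (simp add: AL_def overflow_prob_def)
  also have "(\<Sum>E\<in>?M. prob (B E)) = (\<Sum>E\<in>?M. \<Prod>j\<in>E. overflow_prob {j} (intensity Q j + \<epsilon>) t (x / N))"
    using minimal_sets_heavy t unfolding B_def by (intro sum.cong refl prob_all_large) auto
  also have "(\<Sum>S\<in>dominant_sets. prob (C S) + prob (D S)) =
      (\<Sum>S\<in>dominant_sets. overflow_prob S (cap Q S - \<delta>) t (x - y) +
       (\<Prod>j\<in>S. overflow_prob {j} (intensity Q j + \<epsilon>) t (x / N)) *
       overflow_prob (flows Q - S) (rho Q (flows Q - S) + \<delta>) t y)"
    unfolding C_def D_def overflow_prob_def[of _ "cap Q _ - \<delta>", symmetric] using dominant_sets_heavy t
    by (intro sum.cong refl arg_cong2[of _ _ _ _ "(+)"] prob_all_large_and_remainder) auto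
  finally show ?thesis .
qed

text \<open>A dominant $S$ that overflows while the remaining flows are not much in deficit makes the whole queue
overflow, and the two conditions are independent. When $S$ and $T$ do so together, all flows in $S$ and
in addition the flow $k(S, T) \in T - S$ are large.\<close>

lemma overflow_prob_lower:
  assumes \<epsilon>: "noncritical_margin \<epsilon>" and t: "0 \<le> t" and \<delta>: "0 \<le> \<delta>"
    and k: "\<And>S T. S \<in> dominant_sets \<Longrightarrow> T \<in> dominant_sets - {S} \<Longrightarrow> k S T \<in> T - S"
  shows "(\<Sum>S\<in>dominant_sets. overflow_prob S (cap Q S + \<delta>) t (x + y) *
      (1 - measure (sample Q) {\<omega> \<in> space (sample Q).
         y < deficit Q (flows Q - S) (rho Q (flows Q - S) - \<delta>) t \<omega>})) -
    (\<Sum>S\<in>dominant_sets. \<Sum>T\<in>dominant_sets - {S}.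
      (\<Prod>j\<in>S. overflow_prob {j} (intensity Q j + \<epsilon>) t (x + y)) *
      overflow_prob {k S T} (intensity Q (k S T) + \<epsilon>) t (x + y))
    \<le> overflow_prob (flows Q) 1 t x"
proof -
  interpret prob_space "sample Q"
    by (rule prob)
  let ?sp = "space (sample Q)"
  let ?Z = "\<lambda>S. {\<omega> \<in> ?sp. y < deficit Q (flows Q - S) (rho Q (flows Q - S) - \<delta>) t \<omega>}"
  let ?V = "\<lambda>S. {\<omega> \<in> ?sp. x + y < workload Q S (cap Q S + \<delta>) t \<omega>}"
  have evV: "?V S \<in> events" and evZ: "?Z S \<in> events" if "S \<in> dominant_sets" for S
    using dominant_sets_heavy[OF that] t
    by (auto intro!: workload_event union_of_blocks_heavy deficit_event union_of_blocks_remainder)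
  have V: "prob (?V S - ?Z S) = overflow_prob S (cap Q S + \<delta>) t (x + y) * (1 - prob (?Z S))"
    if S: "S \<in> dominant_sets" for S
  proof -
    have "prob (?V S - ?Z S) = prob (?V S) - prob (?V S \<inter> ?Z S)"
      using evV[OF S] evZ[OF S] by (intro finite_measure_Diff') auto
    also have "?V S \<inter> ?Z S = {\<omega> \<in> ?sp. x + y < workload Q S (cap Q S + \<delta>) t \<omega> \<and>
        y < deficit Q (flows Q - S) (rho Q (flows Q - S) - \<delta>) t \<omega>}"
      by auto
    also have "prob \<dots> = overflow_prob S (cap Q S + \<delta>) t (x + y) * prob (?Z S)"
      using dominant_sets_heavy[OF S] t by (intro prob_workload_and_deficit) auto
    finally show ?thesis
      by (simp add: overflow_prob_def algebra_simps)
  qed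
  have VV: "prob ((?V S - ?Z S) \<inter> (?V T - ?Z T)) \<le>
      (\<Prod>j\<in>S. overflow_prob {j} (intensity Q j + \<epsilon>) t (x + y)) *
      overflow_prob {k S T} (intensity Q (k S T) + \<epsilon>) t (x + y)"
    if S: "S \<in> dominant_sets" and T: "T \<in> dominant_sets - {S}" for S T
  proof -
    let ?U = "insert (k S T) S"
    have k': "k S T \<in> T" "k S T \<notin> S"
      using k[OF S T] by auto
    have U: "?U \<subseteq> heavy Q"
      using k' dominant_sets_heavy[of S] dominant_sets_heavy[of T] S T by blast
    have "prob ((?V S - ?Z S) \<inter> (?V T - ?Z T)) \<le>
        prob {\<omega> \<in> ?sp. \<forall>j\<in>?U. x + y < workload Q {j} (intensity Q j + \<epsilon>) t \<omega>}"
    proof (rule finite_measure_mono)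
      show "(?V S - ?Z S) \<inter> (?V T - ?Z T) \<subseteq>
          {\<omega> \<in> ?sp. \<forall>j\<in>?U. x + y < workload Q {j} (intensity Q j + \<epsilon>) t \<omega>}"
        using minimally_critical_all_large[OF weakly_dominant_minimally_critical \<epsilon> \<delta> _ t] S T k'(1)
        by auto
      show "{\<omega> \<in> ?sp. \<forall>j\<in>?U. x + y < workload Q {j} (intensity Q j + \<epsilon>) t \<omega>} \<in> events"
        using U t finite_subset[OF U finite_heavy]
        by (intro sets.sets_Collect_finite_All' workload_event union_of_blocks_heavy) auto
    qed
    also have "\<dots> = (\<Prod>j\<in>?U. overflow_prob {j} (intensity Q j + \<epsilon>) t (x + y))"
      by (rule prob_all_large[OF U _ t]) simp
    also have "\<dots> = (\<Prod>j\<in>S. overflow_prob {j} (intensity Q j + \<epsilon>) t (x + y)) *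
        overflow_prob {k S T} (intensity Q (k S T) + \<epsilon>) t (x + y)"
      using k'(2) finite_subset[OF U finite_heavy] by (simp add: mult.commute)
    finally show ?thesis .
  qed
  have "(\<Sum>S\<in>dominant_sets. overflow_prob S (cap Q S + \<delta>) t (x + y) * (1 - prob (?Z S))) -
      (\<Sum>S\<in>dominant_sets. \<Sum>T\<in>dominant_sets - {S}.
        (\<Prod>j\<in>S. overflow_prob {j} (intensity Q j + \<epsilon>) t (x + y)) *
        overflow_prob {k S T} (intensity Q (k S T) + \<epsilon>) t (x + y)) \<le>
      (\<Sum>S\<in>dominant_sets. prob (?V S - ?Z S)) -
      (\<Sum>S\<in>dominant_sets. \<Sum>T\<in>dominant_sets - {S}. prob ((?V S - ?Z S) \<inter> (?V T - ?Z T)))"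
    using V VV by (intro diff_mono sum_mono) auto
  also have "\<dots> \<le> prob (\<Union>S\<in>dominant_sets. ?V S - ?Z S)"
    using evV evZ finite_dominant_sets by (intro prob_UNION_ge) auto
  also have "\<dots> \<le> overflow_prob (flows Q) 1 t x"
    unfolding overflow_prob_def
  proof (rule finite_measure_mono)
    show "(\<Union>S\<in>dominant_sets. ?V S - ?Z S) \<subseteq> {\<omega> \<in> ?sp. x < workload Q (flows Q) 1 t \<omega>}"
    proof safe
      fix S \<omega> assume S: "weakly_dominant Q S" and w: "\<omega> \<in> ?sp" "x + y < workload Q S (cap Q S + \<delta>) t \<omega>"
        "\<not> y < deficit Q (flows Q - S) (rho Q (flows Q - S) - \<delta>) t \<omega>"
      then show "x < workload Q (flows Q) 1 t \<omega>"
        using dominant_sets_heavy[of S] heavy_subset_flows t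
        by (intro workload_reduced_lower[of S \<omega> t x y \<delta>]) auto
    qed
  qed (rule workload_event[OF union_of_blocks_flows t])
  finally show ?thesis .
qed

section \<open>Bounds on the limiting tail\<close>

lemma rho_lt_cap: "S \<subseteq> flows Q \<Longrightarrow> \<delta> < 1 - rho Q (flows Q) \<Longrightarrow> rho Q S < cap Q S - \<delta>"
  by (simp add: cap_eq)

lemma V_tail_upper_bound:
  assumes \<epsilon>: "noncritical_margin \<epsilon>" and \<delta>: "0 < \<delta>" "\<delta> < 1 - rho Q (flows Q)" and x: "0 < x"
    and y: "\<And>S. S \<in> dominant_sets \<Longrightarrow> measure (V_law Q (flows Q - S) (rho Q (flows Q - S) + \<delta>)) {y} = 0"
    and ne: "flows Q \<noteq> {}"
  defines "N \<equiv> real (card (flows Q))"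
  shows "V_tail Q (flows Q) 1 x \<le>
    V_tail Q (light Q) (rho Q (light Q) + \<epsilon>) (x / N) +
    (\<Sum>E\<in>minimal_sets - dominant_sets. \<Prod>j\<in>E. V_tail Q {j} (intensity Q j + \<epsilon>) (x / N)) +
    (\<Sum>S\<in>dominant_sets. V_tail Q S (cap Q S - \<delta>) (x - y) +
       (\<Prod>j\<in>S. V_tail Q {j} (intensity Q j + \<epsilon>) (x / N)) *
       V_tail Q (flows Q - S) (rho Q (flows Q - S) + \<delta>) y)"
    (is "?f x \<le> ?g x")
proof -
  have N: "0 < N"
    using ne finite_flows by (simp add: N_def card_gt_0_iff)
  have \<epsilon>0: "0 < \<epsilon>"
    using \<epsilon> by (simp add: noncritical_margin_def)
  have single: "union_of_blocks {j}" "{j} \<subseteq> flows Q" "rho Q {j} < intensity Q j + \<epsilon>" if "j \<in> heavy Q" for j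
    using that \<epsilon>0 heavy_subset_flows by (auto simp: rho_def intro: union_of_blocks_heavy)
  have dom: "union_of_blocks S" "S \<subseteq> flows Q" "rho Q S < cap Q S - \<delta>" "union_of_blocks (flows Q - S)"
    if "S \<in> dominant_sets" for S
    using dominant_sets_heavy[OF that] heavy_subset_flows \<delta>
    by (auto intro!: union_of_blocks_heavy union_of_blocks_remainder rho_lt_cap)
  have min: "E \<subseteq> heavy Q" if "E \<in> minimal_sets - dominant_sets \<or> E \<in> dominant_sets" for E
    using minimal_sets_heavy dominant_sets_heavy that by blast
  have light: "rho Q (light Q) < rho Q (light Q) + \<epsilon>" "light Q \<subseteq> flows Q"
    using \<epsilon>0 by (auto simp: flows_def)
  have a1: "AE z in lborel. (\<lambda>n. overflow_prob (flows Q) 1 (real n) z) \<longlonglongrightarrow> V_tail Q (flows Q) 1 z"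
    using AE_overflow_prob_tendsto[OF union_of_blocks_flows stability, of 1 0] by simp
  have a2: "AE z in lborel. (\<lambda>n. overflow_prob (light Q) (rho Q (light Q) + \<epsilon>) (real n) (z / N)) \<longlonglongrightarrow>
      V_tail Q (light Q) (rho Q (light Q) + \<epsilon>) (z / N)"
    using AE_overflow_prob_tendsto[OF union_of_blocks_light light(1), of "1 / N" 0] N by simp
  have a3: "AE z in lborel. \<forall>j\<in>heavy Q. (\<lambda>n. overflow_prob {j} (intensity Q j + \<epsilon>) (real n) (z / N)) \<longlonglongrightarrow>
      V_tail Q {j} (intensity Q j + \<epsilon>) (z / N)"
  proof (rule AE_finite_allI[OF finite_heavy])
    fix j assume "j \<in> heavy Q"
    from AE_overflow_prob_tendsto[OF single(1,3)[OF this], of "1 / N" 0] N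
    show "AE z in lborel. (\<lambda>n. overflow_prob {j} (intensity Q j + \<epsilon>) (real n) (z / N)) \<longlonglongrightarrow>
      V_tail Q {j} (intensity Q j + \<epsilon>) (z / N)" by simp
  qed
  have a4: "AE z in lborel. \<forall>S\<in>dominant_sets.
      (\<lambda>n. overflow_prob S (cap Q S - \<delta>) (real n) (z - y)) \<longlonglongrightarrow> V_tail Q S (cap Q S - \<delta>) (z - y)"
  proof (rule AE_finite_allI[OF finite_dominant_sets])
    fix S assume "S \<in> dominant_sets"
    from AE_overflow_prob_tendsto[OF dom(1,3)[OF this], of 1 "- y"]
    show "AE z in lborel. (\<lambda>n. overflow_prob S (cap Q S - \<delta>) (real n) (z - y)) \<longlonglongrightarrow>
      V_tail Q S (cap Q S - \<delta>) (z - y)" by simp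
  qed
  have a5: "(\<lambda>n. overflow_prob (flows Q - S) (rho Q (flows Q - S) + \<delta>) (real n) y) \<longlonglongrightarrow>
      V_tail Q (flows Q - S) (rho Q (flows Q - S) + \<delta>) y" if "S \<in> dominant_sets" for S
    using dom(4)[OF that] y[OF that] \<delta> by (intro overflow_prob_tendsto) auto
  show ?thesis
  proof (rule le_of_AE_le_right_continuous[of x ?f ?g])
    show "AE z in lborel. x < z \<longrightarrow> ?f z \<le> ?g z"
      using a1 a2 a3 a4
    proof eventually_elim
      case (elim z)
      show ?case
      proof
        assume z: "x < z"
        have "(\<lambda>n. overflow_prob (light Q) (rho Q (light Q) + \<epsilon>) (real n) (z / N) +
            (\<Sum>E\<in>minimal_sets - dominant_sets. \<Prod>j\<in>E. overflow_prob {j} (intensity Q j + \<epsilon>) (real n) (z / N)) +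
            (\<Sum>S\<in>dominant_sets. overflow_prob S (cap Q S - \<delta>) (real n) (z - y) +
              (\<Prod>j\<in>S. overflow_prob {j} (intensity Q j + \<epsilon>) (real n) (z / N)) *
              overflow_prob (flows Q - S) (rho Q (flows Q - S) + \<delta>) (real n) y)) \<longlonglongrightarrow> ?g z"
          using elim min
          by (intro tendsto_add tendsto_sum tendsto_mult tendsto_prod a5) blast+
        with elim(1) show "?f z \<le> ?g z"
        proof (rule LIMSEQ_le)
          show "\<exists>n0. \<forall>n\<ge>n0. overflow_prob (flows Q) 1 (real n) z \<le>
            overflow_prob (light Q) (rho Q (light Q) + \<epsilon>) (real n) (z / N) +
            (\<Sum>E\<in>minimal_sets - dominant_sets. \<Prod>j\<in>E. overflow_prob {j} (intensity Q j + \<epsilon>) (real n) (z / N)) +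
            (\<Sum>S\<in>dominant_sets. overflow_prob S (cap Q S - \<delta>) (real n) (z - y) +
              (\<Prod>j\<in>S. overflow_prob {j} (intensity Q j + \<epsilon>) (real n) (z / N)) *
              overflow_prob (flows Q - S) (rho Q (flows Q - S) + \<delta>) (real n) y)"
            unfolding N_def using x z
            by (intro exI allI impI overflow_prob_upper[OF \<epsilon>]) auto
        qed
      qed
    qed
    show "(?f \<longlongrightarrow> ?f x) (at_right x)"
      using V_tail_right_continuous[OF _ stability, of 1 0 x] by simp
    have c2: "((\<lambda>z. V_tail Q {j} (intensity Q j + \<epsilon>) (z / N)) \<longlongrightarrow>
        V_tail Q {j} (intensity Q j + \<epsilon>) (x / N)) (at_right x)" if "j \<in> heavy Q" for j
      using V_tail_right_continuous[OF single(2,3)[OF that], of "1 / N" 0 x] N by simp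
    have c1: "((\<lambda>z. V_tail Q (light Q) (rho Q (light Q) + \<epsilon>) (z / N)) \<longlongrightarrow>
        V_tail Q (light Q) (rho Q (light Q) + \<epsilon>) (x / N)) (at_right x)"
      using V_tail_right_continuous[OF light(2,1), of "1 / N" 0 x] N by simp
    have c3: "((\<lambda>z. V_tail Q S (cap Q S - \<delta>) (z - y)) \<longlongrightarrow> V_tail Q S (cap Q S - \<delta>) (x - y)) (at_right x)"
      if "S \<in> dominant_sets" for S
      using V_tail_right_continuous[OF dom(2,3)[OF that], of 1 "- y" x] by simp
    show "(?g \<longlongrightarrow> ?g x) (at_right x)"
      using min
      by (intro tendsto_add tendsto_sum tendsto_mult tendsto_prod tendsto_const c1 c2 c3) blast+
  qed
qed

lemma V_tail_lower_bound:
  assumes \<epsilon>: "noncritical_margin \<epsilon>" and \<delta>: "0 < \<delta>"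
    and L: "\<And>S. S \<in> dominant_sets \<Longrightarrow>
      limiting_law (sample Q) (deficit Q (flows Q - S) (rho Q (flows Q - S) - \<delta>)) (L S)"
    and y: "\<And>S. S \<in> dominant_sets \<Longrightarrow> measure (L S) {y} = 0"
    and k: "\<And>S T. S \<in> dominant_sets \<Longrightarrow> T \<in> dominant_sets - {S} \<Longrightarrow> k S T \<in> T - S"
  shows "(\<Sum>S\<in>dominant_sets. V_tail Q S (cap Q S + \<delta>) (x + y) * (1 - measure (L S) {y<..})) -
    (\<Sum>S\<in>dominant_sets. \<Sum>T\<in>dominant_sets - {S}.
      (\<Prod>j\<in>S. V_tail Q {j} (intensity Q j + \<epsilon>) (x + y)) *
      V_tail Q {k S T} (intensity Q (k S T) + \<epsilon>) (x + y))
    \<le> V_tail Q (flows Q) 1 x"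
    (is "?f x \<le> ?g x")
proof -
  have \<epsilon>0: "0 < \<epsilon>"
    using \<epsilon> by (simp add: noncritical_margin_def)
  have single: "union_of_blocks {j}" "{j} \<subseteq> flows Q" "rho Q {j} < intensity Q j + \<epsilon>" if "j \<in> heavy Q" for j
    using that \<epsilon>0 heavy_subset_flows by (auto simp: rho_def intro: union_of_blocks_heavy)
  have dom: "union_of_blocks S" "S \<subseteq> flows Q" "rho Q S < cap Q S + \<delta>" "union_of_blocks (flows Q - S)"
    if "S \<in> dominant_sets" for S
    using dominant_sets_heavy[OF that] heavy_subset_flows \<delta> rho_lt_cap[of S "- \<delta>"] stability
    by (auto intro!: union_of_blocks_heavy union_of_blocks_remainder)
  have kh: "k S T \<in> heavy Q" if "S \<in> dominant_sets" "T \<in> dominant_sets - {S}" for S T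
    using k[OF that] dominant_sets_heavy[of T] that by blast
  have a1: "AE z in lborel. (\<lambda>n. overflow_prob (flows Q) 1 (real n) z) \<longlonglongrightarrow> V_tail Q (flows Q) 1 z"
    using AE_overflow_prob_tendsto[OF union_of_blocks_flows stability, of 1 0] by simp
  have a3: "AE z in lborel. \<forall>j\<in>heavy Q. (\<lambda>n. overflow_prob {j} (intensity Q j + \<epsilon>) (real n) (z + y)) \<longlonglongrightarrow>
      V_tail Q {j} (intensity Q j + \<epsilon>) (z + y)"
  proof (rule AE_finite_allI[OF finite_heavy])
    fix j assume "j \<in> heavy Q"
    from AE_overflow_prob_tendsto[OF single(1,3)[OF this], of 1 y]
    show "AE z in lborel. (\<lambda>n. overflow_prob {j} (intensity Q j + \<epsilon>) (real n) (z + y)) \<longlonglongrightarrow>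
      V_tail Q {j} (intensity Q j + \<epsilon>) (z + y)" by simp
  qed
  have a4: "AE z in lborel. \<forall>S\<in>dominant_sets.
      (\<lambda>n. overflow_prob S (cap Q S + \<delta>) (real n) (z + y)) \<longlonglongrightarrow> V_tail Q S (cap Q S + \<delta>) (z + y)"
  proof (rule AE_finite_allI[OF finite_dominant_sets])
    fix S assume "S \<in> dominant_sets"
    from AE_overflow_prob_tendsto[OF dom(1,3)[OF this], of 1 y]
    show "AE z in lborel. (\<lambda>n. overflow_prob S (cap Q S + \<delta>) (real n) (z + y)) \<longlonglongrightarrow>
      V_tail Q S (cap Q S + \<delta>) (z + y)" by simp
  qed
  have a5: "(\<lambda>n. measure (sample Q) {\<omega> \<in> space (sample Q).
         y < deficit Q (flows Q - S) (rho Q (flows Q - S) - \<delta>) (real n) \<omega>}) \<longlonglongrightarrow> measure (L S) {y<..}"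
    if "S \<in> dominant_sets" for S
    by (rule limiting_law_tail[OF prob L[OF that] deficit_measurable[OF dom(4)[OF that]] y[OF that]]) simp
  show ?thesis
  proof (rule le_of_AE_le_right_continuous[of x ?f ?g])
    show "AE z in lborel. x < z \<longrightarrow> ?f z \<le> ?g z"
      using a1 a3 a4
    proof eventually_elim
      case (elim z)
      have "(\<lambda>n. (\<Sum>S\<in>dominant_sets. overflow_prob S (cap Q S + \<delta>) (real n) (z + y) *
          (1 - measure (sample Q) {\<omega> \<in> space (sample Q).
            y < deficit Q (flows Q - S) (rho Q (flows Q - S) - \<delta>) (real n) \<omega>})) -
        (\<Sum>S\<in>dominant_sets. \<Sum>T\<in>dominant_sets - {S}.
          (\<Prod>j\<in>S. overflow_prob {j} (intensity Q j + \<epsilon>) (real n) (z + y)) *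
          overflow_prob {k S T} (intensity Q (k S T) + \<epsilon>) (real n) (z + y))) \<longlonglongrightarrow> ?f z"
      proof (intro tendsto_diff tendsto_sum tendsto_mult tendsto_prod tendsto_const a5)
        show "(\<lambda>n. overflow_prob {j} (intensity Q j + \<epsilon>) (real n) (z + y)) \<longlonglongrightarrow>
            V_tail Q {j} (intensity Q j + \<epsilon>) (z + y)" if "S \<in> dominant_sets" "j \<in> S" for S j
          using elim dominant_sets_heavy[OF that(1)] that(2) by blast
      qed (use elim kh in blast)+
      from this elim(1) have "?f z \<le> ?g z"
        by (rule LIMSEQ_le) (use \<delta> in \<open>intro exI allI impI overflow_prob_lower[OF \<epsilon> _ _ k]; auto\<close>)
      then show ?case ..
    qed
    show "(?g \<longlongrightarrow> ?g x) (at_right x)"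
      using V_tail_right_continuous[OF _ stability, of 1 0 x] by simp
    have c2: "((\<lambda>z. V_tail Q {j} (intensity Q j + \<epsilon>) (z + y)) \<longlongrightarrow>
        V_tail Q {j} (intensity Q j + \<epsilon>) (x + y)) (at_right x)" if "j \<in> heavy Q" for j
      using V_tail_right_continuous[OF single(2,3)[OF that], of 1 y x] by simp
    have c3: "((\<lambda>z. V_tail Q S (cap Q S + \<delta>) (z + y)) \<longlongrightarrow> V_tail Q S (cap Q S + \<delta>) (x + y)) (at_right x)"
      if "S \<in> dominant_sets" for S
      using V_tail_right_continuous[OF dom(2,3)[OF that], of 1 y x] by simp
    show "(?f \<longlongrightarrow> ?f x) (at_right x)"
      using dominant_sets_heavy kh
      by (intro tendsto_diff tendsto_sum tendsto_mult tendsto_prod tendsto_const c2 c3) blast+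
  qed
qed

section \<open>Comparison with the reduced-load tails\<close>

text \<open>The constants are chosen in the order $\delta$, $y$, $x$: first $\delta$ such that passing from $c_S$ to
$c_S - \delta$ costs at most a factor $1 + \eta$, whatever the shift $y$; then $y$ such that the
remaining flows exceed it with probability below $\eta$; finally $x$. The bound $K$ controls the
product over $S$ relative to the tail of $S$ and does not depend on $\eta$.\<close>

lemma V_tail_eventually_le:
  assumes \<epsilon>: "noncritical_margin \<epsilon>" and ne: "dominant_sets \<noteq> {}" and K0: "0 \<le> K" and \<eta>: "0 < \<eta>"
  defines "N \<equiv> real (card (flows Q))"
  assumes pos: "\<And>S. S \<in> dominant_sets \<Longrightarrow> \<forall>\<^sub>F x in at_top. 0 < V_tail Q S (cap Q S) x"
    and K: "\<And>S. S \<in> dominant_sets \<Longrightarrow> \<forall>\<^sub>F x in at_top.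
      (\<Prod>j\<in>S. V_tail Q {j} (intensity Q j + \<epsilon>) (x / N)) \<le> K * V_tail Q S (cap Q S) x"
    and light: "\<And>S. S \<in> dominant_sets \<Longrightarrow>
      ((\<lambda>x. V_tail Q (light Q) (rho Q (light Q) + \<epsilon>) (x / N) / V_tail Q S (cap Q S) x) \<longlongrightarrow> 0) at_top"
    and min: "\<And>S E. S \<in> dominant_sets \<Longrightarrow> E \<in> minimal_sets - dominant_sets \<Longrightarrow>
      ((\<lambda>x. (\<Prod>j\<in>E. V_tail Q {j} (intensity Q j + \<epsilon>) (x / N)) / V_tail Q S (cap Q S) x) \<longlongrightarrow> 0) at_top"
    and G: "\<And>S. S \<in> dominant_sets \<Longrightarrow> \<forall>\<^sub>F \<delta> in at_right 0. \<forall>y. \<forall>\<^sub>F x in at_top.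
      V_tail Q S (cap Q S - \<delta>) (x - y) \<le> (1 + \<eta>) * V_tail Q S (cap Q S) x"
  shows "\<forall>\<^sub>F x in at_top. V_tail Q (flows Q) 1 x \<le>
    (1 + (2 + K + real (card (minimal_sets - dominant_sets))) * \<eta>) * (\<Sum>S\<in>dominant_sets. V_tail Q S (cap Q S) x)"
proof -
  let ?g = "\<lambda>S x. V_tail Q S (cap Q S) x"
  let ?M = "minimal_sets - dominant_sets"
  obtain S0 where S0: "S0 \<in> dominant_sets"
    using ne by blast
  have fne: "flows Q \<noteq> {}"
    using dominant_sets_heavy[OF S0] heavy_subset_flows by blast
  have "\<forall>\<^sub>F \<delta> in at_right (0::real). \<forall>S\<in>dominant_sets. \<forall>y. \<forall>\<^sub>F x in at_top.
      V_tail Q S (cap Q S - \<delta>) (x - y) \<le> (1 + \<eta>) * ?g S x"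
    using G by (intro eventually_ball_finite finite_dominant_sets ballI)
  moreover have "\<forall>\<^sub>F \<delta> in at_right 0. \<delta> \<in> {0<..<1 - rho Q (flows Q)}"
    using stability by (intro eventually_at_right_real) simp
  ultimately have "\<forall>\<^sub>F \<delta> in at_right (0::real). (\<forall>S\<in>dominant_sets. \<forall>y. \<forall>\<^sub>F x in at_top.
      V_tail Q S (cap Q S - \<delta>) (x - y) \<le> (1 + \<eta>) * ?g S x) \<and> 0 < \<delta> \<and> \<delta> < 1 - rho Q (flows Q)"
    by eventually_elim auto
  from eventually_happens'[OF _ this] obtain \<delta> where \<delta>: "0 < \<delta>" "\<delta> < 1 - rho Q (flows Q)"
    and G': "\<And>S y. S \<in> dominant_sets \<Longrightarrow>
      \<forall>\<^sub>F x in at_top. V_tail Q S (cap Q S - \<delta>) (x - y) \<le> (1 + \<eta>) * ?g S x"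
    by auto
  let ?R = "\<lambda>S. V_tail Q (flows Q - S) (rho Q (flows Q - S) + \<delta>)"
  have "\<forall>\<^sub>F y in at_top. \<forall>S\<in>dominant_sets. ?R S y < \<eta>"
    using \<delta> \<eta> by (intro eventually_ball_finite finite_dominant_sets ballI
        order_tendstoD(2)[OF V_tail_tendsto_0]) auto
  then obtain Y where Y: "\<And>y S. Y \<le> y \<Longrightarrow> S \<in> dominant_sets \<Longrightarrow> ?R S y < \<eta>"
    unfolding eventually_at_top_linorder by blast
  have "AE y in lborel. \<forall>S\<in>dominant_sets. measure (V_law Q (flows Q - S) (rho Q (flows Q - S) + \<delta>)) {y} = 0"
  proof (rule AE_finite_allI[OF finite_dominant_sets])
    fix S
    show "AE y in lborel. measure (V_law Q (flows Q - S) (rho Q (flows Q - S) + \<delta>)) {y} = 0"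
      using AE_atomless_affine[OF real_distribution_V_law, of "flows Q - S" "rho Q (flows Q - S) + \<delta>" 1 0] \<delta>
      by simp
  qed
  from AE_lborel_obtains_in_interval[OF this, of Y "Y + 1"] obtain y where y: "Y < y"
    "\<And>S. S \<in> dominant_sets \<Longrightarrow> measure (V_law Q (flows Q - S) (rho Q (flows Q - S) + \<delta>)) {y} = 0"
    by auto
  have e1: "\<forall>\<^sub>F x in at_top. \<forall>S\<in>dominant_sets. V_tail Q S (cap Q S - \<delta>) (x - y) \<le> (1 + \<eta>) * ?g S x"
    using G' by (intro eventually_ball_finite finite_dominant_sets ballI)
  have e2: "\<forall>\<^sub>F x in at_top. \<forall>S\<in>dominant_sets.
      (\<Prod>j\<in>S. V_tail Q {j} (intensity Q j + \<epsilon>) (x / N)) \<le> K * ?g S x"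
    using K by (intro eventually_ball_finite finite_dominant_sets ballI)
  have e3: "\<forall>\<^sub>F x in at_top. V_tail Q (light Q) (rho Q (light Q) + \<epsilon>) (x / N) / ?g S0 x < \<eta>"
    using order_tendstoD(2)[OF light[OF S0] \<eta>] .
  have e4: "\<forall>\<^sub>F x in at_top. \<forall>E\<in>?M. (\<Prod>j\<in>E. V_tail Q {j} (intensity Q j + \<epsilon>) (x / N)) / ?g S0 x < \<eta>"
    using order_tendstoD(2)[OF min[OF S0] \<eta>] finite_minimal_sets
    by (intro eventually_ball_finite ballI) auto
  show ?thesis
    using e1 e2 e3 e4 pos[OF S0] eventually_gt_at_top[of 0]
  proof eventually_elim
    case (elim x)
    let ?s = "\<Sum>S\<in>dominant_sets. ?g S x"
    have s0: "?g S0 x \<le> ?s"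
      by (rule member_le_sum[OF S0 V_tail_nonneg finite_dominant_sets])
    then have \<eta>s: "\<eta> * ?g S0 x \<le> \<eta> * ?s"
      using \<eta> by (intro mult_left_mono) auto
    have b1: "V_tail Q (light Q) (rho Q (light Q) + \<epsilon>) (x / N) \<le> \<eta> * ?s"
      using elim(3,5) \<eta>s by (simp add: divide_less_eq)
    have "(\<Prod>j\<in>E. V_tail Q {j} (intensity Q j + \<epsilon>) (x / N)) \<le> \<eta> * ?s" if "E \<in> ?M" for E
      using bspec[OF elim(4) that] elim(5) \<eta>s by (simp add: divide_less_eq)
    then have b2: "(\<Sum>E\<in>?M. \<Prod>j\<in>E. V_tail Q {j} (intensity Q j + \<epsilon>) (x / N)) \<le> real (card ?M) * (\<eta> * ?s)"
      by (rule sum_bounded_above)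
    have b3: "(\<Sum>S\<in>dominant_sets. V_tail Q S (cap Q S - \<delta>) (x - y) +
        (\<Prod>j\<in>S. V_tail Q {j} (intensity Q j + \<epsilon>) (x / N)) * ?R S y) \<le>
        (\<Sum>S\<in>dominant_sets. (1 + \<eta>) * ?g S x + K * ?g S x * \<eta>)"
    proof (rule sum_mono)
      fix S assume S: "S \<in> dominant_sets"
      have "(\<Prod>j\<in>S. V_tail Q {j} (intensity Q j + \<epsilon>) (x / N)) * ?R S y \<le> (K * ?g S x) * \<eta>"
        using bspec[OF elim(2) S] Y[OF less_imp_le[OF y(1)] S] K0 V_tail_nonneg
        by (intro mult_mono mult_nonneg_nonneg) (auto simp: less_imp_le)
      with bspec[OF elim(1) S]
      show "V_tail Q S (cap Q S - \<delta>) (x - y) +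
          (\<Prod>j\<in>S. V_tail Q {j} (intensity Q j + \<epsilon>) (x / N)) * ?R S y \<le>
        (1 + \<eta>) * ?g S x + K * ?g S x * \<eta>"
        by (rule add_mono)
    qed
    have "(\<Sum>S\<in>dominant_sets. (1 + \<eta>) * ?g S x + K * ?g S x * \<eta>) = (1 + \<eta> + K * \<eta>) * ?s"
      unfolding sum_distrib_left by (intro sum.cong refl) (simp add: algebra_simps)
    with b1 b2 b3 V_tail_upper_bound[OF \<epsilon> \<delta> elim(6) y(2) fne, folded N_def]
    have "V_tail Q (flows Q) 1 x \<le> \<eta> * ?s + real (card ?M) * (\<eta> * ?s) + (1 + \<eta> + K * \<eta>) * ?s"
      by linarith
    also have "\<dots> = (1 + (2 + K + real (card ?M)) * \<eta>) * ?s"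
      by (simp add: algebra_simps)
    finally show ?case .
  qed
qed

lemma dominant_sets_diff:
  assumes "S \<in> dominant_sets" "T \<in> dominant_sets - {S}"
  shows "T - S \<noteq> {}"
proof
  assume "T - S = {}"
  then have "T \<subset> S"
    using assms(2) by blast
  moreover have "critical Q T" "minimally_critical Q S"
    using assms weakly_dominant_minimally_critical by (auto simp: minimally_critical_def)
  ultimately show False
    by (simp add: minimally_critical_def)
qed

text \<open>The order of choices is the same as for the upper bound. A pair of different dominant sets contributes
at most $K$ times the tail of the first set, times the tail of one further flow, which vanishes.\<close>

lemma V_tail_eventually_ge:
  assumes \<epsilon>: "noncritical_margin \<epsilon>" and K0: "0 \<le> K" and \<eta>: "0 < \<eta>" "\<eta> < 1"
  defines "N \<equiv> real (card (flows Q))"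
  assumes K: "\<And>S. S \<in> dominant_sets \<Longrightarrow> \<forall>\<^sub>F x in at_top.
      (\<Prod>j\<in>S. V_tail Q {j} (intensity Q j + \<epsilon>) (x / N)) \<le> K * V_tail Q S (cap Q S) x"
    and F: "\<And>S. S \<in> dominant_sets \<Longrightarrow> \<forall>\<^sub>F \<delta> in at_right 0. \<forall>y. \<forall>\<^sub>F x in at_top.
      (1 - \<eta>) * V_tail Q S (cap Q S) x \<le> V_tail Q S (cap Q S + \<delta>) (x + y)"
  shows "\<forall>\<^sub>F x in at_top.
    (1 - (2 + K * real (card dominant_sets)) * \<eta>) * (\<Sum>S\<in>dominant_sets. V_tail Q S (cap Q S) x)
    \<le> V_tail Q (flows Q) 1 x"
proof -
  let ?g = "\<lambda>S x. V_tail Q S (cap Q S) x"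
  have \<epsilon>0: "0 < \<epsilon>"
    using \<epsilon> by (simp add: noncritical_margin_def)
  have "\<forall>\<^sub>F \<delta> in at_right (0::real). \<forall>S\<in>dominant_sets. \<forall>y. \<forall>\<^sub>F x in at_top.
      (1 - \<eta>) * ?g S x \<le> V_tail Q S (cap Q S + \<delta>) (x + y)"
    using F by (intro eventually_ball_finite finite_dominant_sets ballI)
  moreover have "\<forall>\<^sub>F \<delta> in at_right (0::real). 0 < \<delta>"
    by (rule eventually_at_right_less)
  ultimately have "\<forall>\<^sub>F \<delta> in at_right (0::real). (\<forall>S\<in>dominant_sets. \<forall>y. \<forall>\<^sub>F x in at_top.
      (1 - \<eta>) * ?g S x \<le> V_tail Q S (cap Q S + \<delta>) (x + y)) \<and> 0 < \<delta>"
    by eventually_elim auto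
  from eventually_happens'[OF _ this] obtain \<delta> where \<delta>: "0 < \<delta>"
    and F': "\<And>S y. S \<in> dominant_sets \<Longrightarrow>
      \<forall>\<^sub>F x in at_top. (1 - \<eta>) * ?g S x \<le> V_tail Q S (cap Q S + \<delta>) (x + y)"
    by auto
  have "\<forall>S\<in>dominant_sets. \<exists>L.
      limiting_law (sample Q) (deficit Q (flows Q - S) (rho Q (flows Q - S) - \<delta>)) L"
    using \<delta> by (intro ballI deficit_limit) auto
  from bchoice[OF this] obtain L where L: "\<And>S. S \<in> dominant_sets \<Longrightarrow>
      limiting_law (sample Q) (deficit Q (flows Q - S) (rho Q (flows Q - S) - \<delta>)) (L S)"
    by blast
  have LL: "real_distribution (L S)" if "S \<in> dominant_sets" for S
    using L[OF that] by (simp add: limiting_law_def)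
  have "\<forall>\<^sub>F y in at_top. \<forall>S\<in>dominant_sets. measure (L S) {y<..} < \<eta>"
    using \<eta> LL by (intro eventually_ball_finite finite_dominant_sets ballI
        order_tendstoD(2)[OF tail_tendsto_0])
  then obtain Y where Y: "\<And>y S. Y \<le> y \<Longrightarrow> S \<in> dominant_sets \<Longrightarrow> measure (L S) {y<..} < \<eta>"
    unfolding eventually_at_top_linorder by blast
  have "AE y in lborel. \<forall>S\<in>dominant_sets. measure (L S) {y} = 0"
    using AE_atomless_affine[OF LL, of _ 1 0] by (intro AE_finite_allI finite_dominant_sets) simp
  from AE_lborel_obtains_in_interval[OF this, of "max Y 0" "max Y 0 + 1"] obtain y where y: "Y < y" "0 < y"
    "\<And>S. S \<in> dominant_sets \<Longrightarrow> measure (L S) {y} = 0"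
    by auto
  define k where "k S T = (SOME i. i \<in> T - S)" for S T :: "'i set"
  have k: "k S T \<in> T - S" if "S \<in> dominant_sets" "T \<in> dominant_sets - {S}" for S T
    unfolding k_def using dominant_sets_diff[OF that] by (rule some_in_eq[THEN iffD2])
  have e1: "\<forall>\<^sub>F x in at_top. \<forall>S\<in>dominant_sets. (1 - \<eta>) * ?g S x \<le> V_tail Q S (cap Q S + \<delta>) (x + y)"
    using F' by (intro eventually_ball_finite finite_dominant_sets ballI)
  have e2: "\<forall>\<^sub>F x in at_top. \<forall>S\<in>dominant_sets.
      (\<Prod>j\<in>S. V_tail Q {j} (intensity Q j + \<epsilon>) (x / N)) \<le> K * ?g S x"
    using K by (intro eventually_ball_finite finite_dominant_sets ballI)
  have single: "{j} \<subseteq> flows Q" "rho Q {j} < intensity Q j + \<epsilon>" if "j \<in> heavy Q" for j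
    using that \<epsilon>0 heavy_subset_flows by (auto simp: rho_def)
  have e3: "\<forall>\<^sub>F x in at_top. \<forall>j\<in>heavy Q. V_tail Q {j} (intensity Q j + \<epsilon>) x < \<eta>"
    using single \<eta> by (intro eventually_ball_finite finite_heavy ballI
        order_tendstoD(2)[OF V_tail_tendsto_0])
  show ?thesis
    using e1 e2 e3 eventually_gt_at_top[of 0]
  proof eventually_elim
    case (elim x)
    let ?s = "\<Sum>S\<in>dominant_sets. ?g S x"
    \<comment> \<open>The factor is $(1 - \eta)^2 \ge 1 - 2 \eta$: one $1 - \eta$ for the change of rate and one for the deficit.\<close>
    have V: "(1 - 2 * \<eta>) * ?g S x \<le> V_tail Q S (cap Q S + \<delta>) (x + y) * (1 - measure (L S) {y<..})"
      if S: "S \<in> dominant_sets" for S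
    proof -
      have "(1 - 2 * \<eta>) * ?g S x \<le> ((1 - \<eta>) * (1 - \<eta>)) * ?g S x"
        using V_tail_nonneg by (intro mult_right_mono) (auto simp: algebra_simps)
      also have "\<dots> = (1 - \<eta>) * ?g S x * (1 - \<eta>)"
        by simp
      also have "\<dots> \<le> V_tail Q S (cap Q S + \<delta>) (x + y) * (1 - measure (L S) {y<..})"
        using bspec[OF elim(1) S] Y[OF less_imp_le[OF y(1)] S] \<eta> V_tail_nonneg
        by (intro mult_mono) auto
      finally show ?thesis .
    qed
    have VV: "(\<Prod>j\<in>S. V_tail Q {j} (intensity Q j + \<epsilon>) (x + y)) *
        V_tail Q {k S T} (intensity Q (k S T) + \<epsilon>) (x + y) \<le> K * ?g S x * \<eta>"
      if S: "S \<in> dominant_sets" and T: "T \<in> dominant_sets - {S}" for S T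
    proof (rule mult_mono)
      have kh: "k S T \<in> heavy Q"
        using k[OF S T] dominant_sets_heavy[of T] T by blast
      have "flows Q \<noteq> {}"
        using kh by (auto simp: flows_def)
      then have "1 \<le> N"
        using finite_flows by (simp add: N_def Suc_le_eq card_gt_0_iff)
      then have "x / N \<le> x"
        using elim(4) by (simp add: divide_le_eq)
      then have "(\<Prod>j\<in>S. V_tail Q {j} (intensity Q j + \<epsilon>) (x + y)) \<le>
          (\<Prod>j\<in>S. V_tail Q {j} (intensity Q j + \<epsilon>) (x / N))"
        using y(2) single dominant_sets_heavy[OF S]
        by (intro prod_mono conjI V_tail_antimono V_tail_nonneg) auto
      also have "\<dots> \<le> K * ?g S x"
        using elim(2) S by blast
      finally show "(\<Prod>j\<in>S. V_tail Q {j} (intensity Q j + \<epsilon>) (x + y)) \<le> K * ?g S x" .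
      have "V_tail Q {k S T} (intensity Q (k S T) + \<epsilon>) (x + y) \<le>
          V_tail Q {k S T} (intensity Q (k S T) + \<epsilon>) x"
        using single[OF kh] y(2) by (intro V_tail_antimono) auto
      then show "V_tail Q {k S T} (intensity Q (k S T) + \<epsilon>) (x + y) \<le> \<eta>"
        using bspec[OF elim(3) kh] by simp
    qed (use K0 V_tail_nonneg in auto)
    have pairs: "(\<Sum>T\<in>dominant_sets - {S}. (\<Prod>j\<in>S. V_tail Q {j} (intensity Q j + \<epsilon>) (x + y)) *
        V_tail Q {k S T} (intensity Q (k S T) + \<epsilon>) (x + y)) \<le>
        real (card dominant_sets) * (K * ?g S x * \<eta>)" if S: "S \<in> dominant_sets" for S
    proof -
      have "(\<Sum>T\<in>dominant_sets - {S}. (\<Prod>j\<in>S. V_tail Q {j} (intensity Q j + \<epsilon>) (x + y)) *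
        V_tail Q {k S T} (intensity Q (k S T) + \<epsilon>) (x + y)) \<le>
        real (card (dominant_sets - {S})) * (K * ?g S x * \<eta>)"
        using VV[OF S] by (rule sum_bounded_above)
      also have "\<dots> \<le> real (card dominant_sets) * (K * ?g S x * \<eta>)"
        using K0 \<eta> V_tail_nonneg finite_dominant_sets
        by (intro mult_right_mono mult_nonneg_nonneg of_nat_mono card_mono) auto
      finally show ?thesis .
    qed
    have "(1 - (2 + K * real (card dominant_sets)) * \<eta>) * ?s = (\<Sum>S\<in>dominant_sets. (1 - 2 * \<eta>) * ?g S x) -
        (\<Sum>S\<in>dominant_sets. real (card dominant_sets) * (K * ?g S x * \<eta>))"
      unfolding sum_subtractf[symmetric] sum_distrib_left
      by (intro sum.cong refl) (simp add: algebra_simps)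
    also have "(\<Sum>S\<in>dominant_sets. (1 - 2 * \<eta>) * ?g S x) -
        (\<Sum>S\<in>dominant_sets. real (card dominant_sets) * (K * ?g S x * \<eta>)) \<le>
      (\<Sum>S\<in>dominant_sets. V_tail Q S (cap Q S + \<delta>) (x + y) * (1 - measure (L S) {y<..})) -
      (\<Sum>S\<in>dominant_sets. \<Sum>T\<in>dominant_sets - {S}.
        (\<Prod>j\<in>S. V_tail Q {j} (intensity Q j + \<epsilon>) (x + y)) *
        V_tail Q {k S T} (intensity Q (k S T) + \<epsilon>) (x + y))"
      using V pairs by (intro diff_mono sum_mono)
    also have "\<dots> \<le> V_tail Q (flows Q) 1 x"
      by (rule V_tail_lower_bound[OF \<epsilon> \<delta> L y(3) k])
    finally show ?case .
  qed
qed

end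

lemma asymp_equiv_if_eventually_sandwiched:
  fixes f g :: "real \<Rightarrow> real"
  assumes pos: "\<forall>\<^sub>F x in at_top. 0 < g x"
    and le: "\<And>\<eta>. 0 < \<eta> \<Longrightarrow> \<eta> < 1 \<Longrightarrow> \<forall>\<^sub>F x in at_top. f x \<le> (1 + A * \<eta>) * g x"
    and ge: "\<And>\<eta>. 0 < \<eta> \<Longrightarrow> \<eta> < 1 \<Longrightarrow> \<forall>\<^sub>F x in at_top. (1 - B * \<eta>) * g x \<le> f x"
  shows "f \<sim>[at_top] g"
proof (rule asymp_equivI', rule tendstoI)
  fix e :: real assume e: "0 < e"
  define C where "C = \<bar>A\<bar> + \<bar>B\<bar> + 1"
  define \<eta> where "\<eta> = min (1 / 2) (e / (2 * C))"
  have C: "0 < C" "A \<le> C" "B \<le> C"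
    by (auto simp: C_def)
  have \<eta>: "0 < \<eta>" "\<eta> < 1"
    using e C by (auto simp: \<eta>_def)
  have "C * \<eta> \<le> C * (e / (2 * C))"
    using C by (intro mult_left_mono) (auto simp: \<eta>_def)
  then have "C * \<eta> < e"
    using e C by simp
  moreover have "A * \<eta> \<le> C * \<eta>" "B * \<eta> \<le> C * \<eta>"
    using C \<eta> by (auto intro: mult_right_mono)
  ultimately have AB: "A * \<eta> < e" "B * \<eta> < e"
    by linarith+
  show "\<forall>\<^sub>F x in at_top. dist (f x / g x) 1 < e"
    using pos le[OF \<eta>] ge[OF \<eta>]
  proof eventually_elim
    case (elim x)
    then have "f x / g x \<le> 1 + A * \<eta>" "1 - B * \<eta> \<le> f x / g x"
      by (simp_all add: divide_le_eq le_divide_eq)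
    with AB show ?case
      by (simp add: dist_real_def abs_less_iff)
  qed
qed

theorem theorem5p1:
  fixes Q :: "('i, 'a) fluid_queue"
    and \<Upsilon> \<Omega> :: "'i set set" and N :: real
  defines "\<Upsilon> \<equiv> {S. weakly_dominant Q S}"
    and "\<Omega> \<equiv> {S. minimally_critical Q S}"
    and "N \<equiv> real (card (flows Q))"
  assumes model: "fluid_model Q"
    and nonempty: "\<Upsilon> \<noteq> {}"
    and A1: "\<And>S. S \<in> \<Upsilon> \<Longrightarrow>
      \<exists>F :: real \<Rightarrow> ereal.
        (\<forall>\<delta>>0. \<forall>y::real.
          Liminf at_top (\<lambda>x::real. ereal (V_tail Q S (cap Q S + \<delta>) (x + y) / V_tail Q S (cap Q S) x)) = F \<delta>) \<and>
        (F \<longlongrightarrow> 1) (at_right 0)"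
    and A2: "\<And>S. S \<in> \<Upsilon> \<Longrightarrow>
      \<exists>G :: real \<Rightarrow> ereal.
        (\<forall>\<delta>>0. cap Q S - \<delta> > rho Q S \<longrightarrow> (\<forall>y::real.
          Limsup at_top (\<lambda>x::real. ereal (V_tail Q S (cap Q S - \<delta>) (x - y) / V_tail Q S (cap Q S) x)) = G \<delta>)) \<and>
        (G \<longlongrightarrow> 1) (at_right 0)"
    and A3: "\<And>S \<epsilon>. S \<in> \<Upsilon> \<Longrightarrow> \<epsilon> > 0 \<Longrightarrow>
      ((\<lambda>x. V_tail Q (light Q) (rho Q (light Q) + \<epsilon>) (x / N) / V_tail Q S (cap Q S) x) \<longlongrightarrow> 0) at_top"
    and A4: "\<And>S \<epsilon>. S \<in> \<Upsilon> \<Longrightarrow> \<epsilon> > 0 \<Longrightarrow>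
      Limsup at_top (\<lambda>x::real. ereal
        ((\<Prod>j\<in>S. V_tail Q {j} (intensity Q j + \<epsilon>) (x / N)) / V_tail Q S (cap Q S) x)) < \<infinity>"
    and A5: "\<And>S E \<epsilon>. S \<in> \<Upsilon> \<Longrightarrow> E \<in> \<Omega> - \<Upsilon> \<Longrightarrow> \<epsilon> > 0 \<Longrightarrow>
      ((\<lambda>x. (\<Prod>j\<in>E. V_tail Q {j} (intensity Q j + \<epsilon>) (x / N)) / V_tail Q S (cap Q S) x) \<longlongrightarrow> 0) at_top"
  shows "V_tail Q (flows Q) 1 \<sim>[at_top] (\<lambda>x. \<Sum>S\<in>\<Upsilon>. V_tail Q S (cap Q S) x)"
proof -
  interpret fluid_model Q
    by (rule model)
  let ?g = "\<lambda>S x. V_tail Q S (cap Q S) x"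
  note ne = nonempty[unfolded \<Upsilon>_def]
  \<comment> \<open>The same $\varepsilon$ serves the upper and the lower bound and is fixed before $\eta$, so that $K$ may depend on it.\<close>
  obtain \<epsilon> where \<epsilon>: "noncritical_margin \<epsilon>" "0 < \<epsilon>"
    using noncritical_margin_exists by (auto simp: noncritical_margin_def)
  have F_ge: "\<forall>\<^sub>F \<delta> in at_right 0. \<forall>y. \<forall>\<^sub>F x in at_top.
      1 - \<eta> < V_tail Q S (cap Q S + \<delta>) (x + y) / ?g S x"
    if S: "S \<in> dominant_sets" and \<eta>: "0 < \<eta>" for S \<eta>
  proof -
    obtain F :: "real \<Rightarrow> ereal" where F: "\<And>\<delta> y. 0 < \<delta> \<Longrightarrow>
        Liminf at_top (\<lambda>x. ereal (V_tail Q S (cap Q S + \<delta>) (x + y) / ?g S x)) = F \<delta>"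
      "(F \<longlongrightarrow> 1) (at_right 0)"
      using A1[of S] S unfolding \<Upsilon>_def by blast
    have "\<forall>\<^sub>F \<delta> in at_right 0. ereal (1 - \<eta>) < F \<delta>"
      using \<eta> by (intro order_tendstoD(1)[OF F(2)]) (simp add: one_ereal_def)
    then show ?thesis
      using eventually_at_right_less[of 0]
    proof eventually_elim
      case (elim \<delta>)
      show ?case
      proof
        fix y
        from elim F(1)[of \<delta> y] have "ereal (1 - \<eta>) <
            Liminf at_top (\<lambda>x. ereal (V_tail Q S (cap Q S + \<delta>) (x + y) / ?g S x))"
          by simp
        from less_LiminfD[OF this]
        show "\<forall>\<^sub>F x in at_top. 1 - \<eta> < V_tail Q S (cap Q S + \<delta>) (x + y) / ?g S x"
          by simp
      qed
    qed
  qed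
  \<comment> \<open>Division by 0 gives 0, so a ratio that is eventually positive has a positive denominator.\<close>
  have pos: "\<forall>\<^sub>F x in at_top. 0 < ?g S x" if S: "S \<in> dominant_sets" for S
  proof -
    from eventually_happens'[OF _ F_ge[OF S, of 1]] obtain \<delta> where
      "\<forall>y. \<forall>\<^sub>F x in at_top. 1 - 1 < V_tail Q S (cap Q S + \<delta>) (x + y) / ?g S x"
      by auto
    then have "\<forall>\<^sub>F x in at_top. 1 - 1 < V_tail Q S (cap Q S + \<delta>) (x + 0) / ?g S x" ..
    then show ?thesis
      by eventually_elim (use V_tail_nonneg[of S "cap Q S"] in \<open>auto simp: zero_less_divide_iff less_le\<close>)
  qed
  have F: "\<forall>\<^sub>F \<delta> in at_right 0. \<forall>y. \<forall>\<^sub>F x in at_top.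
      (1 - \<eta>) * ?g S x \<le> V_tail Q S (cap Q S + \<delta>) (x + y)"
    if S: "S \<in> dominant_sets" and \<eta>: "0 < \<eta>" for S \<eta>
    using F_ge[OF S \<eta>]
  proof eventually_elim
    case (elim \<delta>)
    show ?case
    proof
      fix y
      from spec[OF elim, of y] pos[OF S]
      show "\<forall>\<^sub>F x in at_top. (1 - \<eta>) * ?g S x \<le> V_tail Q S (cap Q S + \<delta>) (x + y)"
        by eventually_elim (simp add: less_divide_eq)
    qed
  qed
  have G: "\<forall>\<^sub>F \<delta> in at_right 0. \<forall>y. \<forall>\<^sub>F x in at_top.
      V_tail Q S (cap Q S - \<delta>) (x - y) \<le> (1 + \<eta>) * ?g S x"
    if S: "S \<in> dominant_sets" and \<eta>: "0 < \<eta>" for S \<eta>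
  proof -
    obtain G :: "real \<Rightarrow> ereal" where G: "\<And>\<delta> y. 0 < \<delta> \<Longrightarrow> rho Q S < cap Q S - \<delta> \<Longrightarrow>
        Limsup at_top (\<lambda>x. ereal (V_tail Q S (cap Q S - \<delta>) (x - y) / ?g S x)) = G \<delta>"
      "(G \<longlongrightarrow> 1) (at_right 0)"
      using A2[of S] S unfolding \<Upsilon>_def by blast
    have "\<forall>\<^sub>F \<delta> in at_right 0. G \<delta> < ereal (1 + \<eta>)"
      using \<eta> by (intro order_tendstoD(2)[OF G(2)]) (simp add: one_ereal_def)
    moreover have "\<forall>\<^sub>F \<delta> in at_right 0. \<delta> \<in> {0<..<1 - rho Q (flows Q)}"
      using stability by (intro eventually_at_right_real) simp
    ultimately show ?thesis
    proof eventually_elim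
      case (elim \<delta>)
      have "rho Q S < cap Q S - \<delta>"
        using elim dominant_sets_heavy[OF S] heavy_subset_flows by (intro rho_lt_cap) auto
      show ?case
      proof
        fix y
        from elim G(1)[of \<delta> y] \<open>rho Q S < cap Q S - \<delta>\<close> have
          "Limsup at_top (\<lambda>x. ereal (V_tail Q S (cap Q S - \<delta>) (x - y) / ?g S x)) < ereal (1 + \<eta>)"
          by simp
        from Limsup_lessD[OF this] pos[OF S]
        show "\<forall>\<^sub>F x in at_top. V_tail Q S (cap Q S - \<delta>) (x - y) \<le> (1 + \<eta>) * ?g S x"
          by eventually_elim (simp add: divide_less_eq)
      qed
    qed
  qed
  have "\<forall>S\<in>dominant_sets. \<exists>n. \<forall>\<^sub>F x in at_top.
      (\<Prod>j\<in>S. V_tail Q {j} (intensity Q j + \<epsilon>) (x / N)) \<le> real n * ?g S x"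
  proof
    fix S assume S: "S \<in> dominant_sets"
    have "Limsup at_top (\<lambda>x::real. ereal
        ((\<Prod>j\<in>S. V_tail Q {j} (intensity Q j + \<epsilon>) (x / N)) / ?g S x)) < \<infinity>"
      by (rule A4) (use S \<epsilon>(2) in \<open>simp_all add: \<Upsilon>_def\<close>)
    then obtain n where "Limsup at_top (\<lambda>x::real. ereal
        ((\<Prod>j\<in>S. V_tail Q {j} (intensity Q j + \<epsilon>) (x / N)) / ?g S x)) < ereal (real n)"
      using less_PInf_Ex_of_nat[THEN iffD1, OF less_imp_neq] by blast
    from Limsup_lessD[OF this] pos[OF S]
    have "\<forall>\<^sub>F x in at_top. (\<Prod>j\<in>S. V_tail Q {j} (intensity Q j + \<epsilon>) (x / N)) \<le> real n * ?g S x"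
      by eventually_elim (simp add: divide_less_eq)
    then show "\<exists>n. \<forall>\<^sub>F x in at_top.
        (\<Prod>j\<in>S. V_tail Q {j} (intensity Q j + \<epsilon>) (x / N)) \<le> real n * ?g S x" ..
  qed
  from bchoice[OF this] obtain n where n: "\<And>S. S \<in> dominant_sets \<Longrightarrow>
      \<forall>\<^sub>F x in at_top. (\<Prod>j\<in>S. V_tail Q {j} (intensity Q j + \<epsilon>) (x / N)) \<le> real (n S) * ?g S x"
    by blast
  define K where "K = real (\<Sum>S\<in>dominant_sets. n S)"
  have K: "\<forall>\<^sub>F x in at_top. (\<Prod>j\<in>S. V_tail Q {j} (intensity Q j + \<epsilon>) (x / N)) \<le> K * ?g S x"
    if S: "S \<in> dominant_sets" for S
    using n[OF S]
  proof eventually_elim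
    case (elim x)
    have "real (n S) \<le> K"
      unfolding K_def using S finite_dominant_sets by (intro of_nat_mono member_le_sum) auto
    then have "real (n S) * ?g S x \<le> K * ?g S x"
      by (intro mult_right_mono V_tail_nonneg)
    with elim show ?case
      by linarith
  qed
  have K0: "0 \<le> K"
    unfolding K_def by (rule of_nat_0_le_iff)
  have total_pos: "\<forall>\<^sub>F x in at_top. 0 < (\<Sum>S\<in>dominant_sets. ?g S x)"
  proof -
    have "\<forall>\<^sub>F x in at_top. \<forall>S\<in>dominant_sets. 0 < ?g S x"
      using pos by (intro eventually_ball_finite finite_dominant_sets ballI)
    then show ?thesis
      by eventually_elim (use ne finite_dominant_sets in \<open>auto intro!: sum_pos\<close>)
  qed
  show ?thesis
    unfolding \<Upsilon>_def
  proof (rule asymp_equiv_if_eventually_sandwiched[OF total_pos])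
    fix \<eta> :: real assume \<eta>: "0 < \<eta>" "\<eta> < 1"
    show "\<forall>\<^sub>F x in at_top. V_tail Q (flows Q) 1 x \<le>
        (1 + (2 + K + real (card (minimal_sets - dominant_sets))) * \<eta>) * (\<Sum>S\<in>dominant_sets. ?g S x)"
      using A3 A5 \<epsilon>(2)
      by (intro V_tail_eventually_le[OF \<epsilon>(1) ne K0 \<eta>(1) pos K[unfolded N_def] _ _ G[OF _ \<eta>(1)]])
        (simp_all add: \<Upsilon>_def \<Omega>_def N_def)
    show "\<forall>\<^sub>F x in at_top. (1 - (2 + K * real (card dominant_sets)) * \<eta>) *
        (\<Sum>S\<in>dominant_sets. ?g S x) \<le> V_tail Q (flows Q) 1 x"
      by (rule V_tail_eventually_ge[OF \<epsilon>(1) K0 \<eta> K[unfolded N_def] F[OF _ \<eta>(1)]])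
  qed
qed

end
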